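(* Fix an o-minimal structure. Let $D \colon \mathbb{R}^p \rightrightarrows \mathbb{R}^p$ be a conservative field for $f\colon\mathbb{R}^p\to\mathbb{R}$, and assume $f$ and $D$ are definable. Then there exist $\rho > 0$, a definable strictly increasing function $\varphi \colon [0, \rho) \to \mathbb{R}_+$ which is $C^1$ on $(0,\rho)$ with $\varphi(0) = 0$, and a continuous definable function $\chi \colon \mathbb{R}_+ \to (0, + \infty)$, such that for all $x \in \mathbb{R}^p$ with $0< |f(x)| \leq \chi(\|x\|)$ and all $v \in D(x)$, $\|v\|\, \varphi'(|f(x)|) \geq 1$.
   Context: A set valued map $D\colon\mathbb{R}^p\rightrightarrows\mathbb{R}^p$ is a conservative field if its graph is closed, its values are nonempty and compact, and for every absolutely continuous loop $\gamma\colon[0,1]\to\mathbb{R}^p$, $\int_0^1 \max_{v\in D(\gamma(t))}\langle\dot\gamma(t),v\rangle\,dt=0$; $D$ is a conservative field for $f$ if moreover $f(x)=f(0)+\int_0^1\max_{v\in D(\gamma(t))}\langle\dot\gamma(t),v\rangle\,dt$ for every absolutely continuous $\gamma$ from $0$ to $x$. Definable means belonging (via graph, for maps) to a fixed o-minimal structure on $(\mathbb{R},+,\cdot)$ (e.g. semialgebraic sets): a family of Boolean algebras of subsets of $\mathbb{R}^p$ containing algebraic sets, stable under products with $\mathbb{R}$ and coordinate projections, whose subsets of $\mathbb{R}$ are exactly finite unions of intervals and points. *)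

theory Defs
  imports "HOL-Analysis.Analysis"
begin

text \<open>Points of R^n are represented as real lists of length n; a structure is a
family S with S n a collection of subsets of R^n (lists of length n).\<close>

inductive_set poly_fun :: "(real list \<Rightarrow> real) set" where
  pconst: "(\<lambda>x. c) \<in> poly_fun"
| pcoord: "(\<lambda>x. x ! i) \<in> poly_fun"
| padd: "P \<in> poly_fun \<Longrightarrow> Q \<in> poly_fun \<Longrightarrow> (\<lambda>x. P x + Q x) \<in> poly_fun"
| pmult: "P \<in> poly_fun \<Longrightarrow> Q \<in> poly_fun \<Longrightarrow> (\<lambda>x. P x * Q x) \<in> poly_fun"

definition rspace :: "nat \<Rightarrow> real list set" where
  "rspace n = {x. length x = n}"

definition finite_union_intervals :: "real set \<Rightarrow> bool" where
  "finite_union_intervals U \<longleftrightarrow> (\<exists>F. finite F \<and> (\<forall>I\<in>F. is_interval I) \<and> U = \<Union>F)"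

definition o_minimal :: "(nat \<Rightarrow> real list set set) \<Rightarrow> bool" where
  "o_minimal S \<longleftrightarrow>
     (\<forall>n. \<forall>A\<in>S n. A \<subseteq> rspace n)
   \<and> (\<forall>n. {} \<in> S n)
   \<and> (\<forall>n. \<forall>A\<in>S n. \<forall>B\<in>S n. A \<union> B \<in> S n)
   \<and> (\<forall>n. \<forall>A\<in>S n. rspace n - A \<in> S n)
   \<and> (\<forall>n. \<forall>P\<in>poly_fun. {x \<in> rspace n. P x = 0} \<in> S n)
   \<and> (\<forall>n. \<forall>A\<in>S n. {x @ [t] |x t. x \<in> A} \<in> S (Suc n))
   \<and> (\<forall>n. \<forall>A\<in>S n. {t # x |x t. x \<in> A} \<in> S (Suc n))
   \<and> (\<forall>n. \<forall>A\<in>S (Suc n). butlast ` A \<in> S n)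
   \<and> (\<forall>A\<in>S 1. finite_union_intervals {t. [t] \<in> A})"

definition vec_list :: "real ^ 'n::enum \<Rightarrow> real list" where
  "vec_list x = map (\<lambda>i. x $ i) (Enum.enum :: 'n::enum list)"

definition definable_fun :: "(nat \<Rightarrow> real list set set) \<Rightarrow> (real ^ 'n::enum \<Rightarrow> real) \<Rightarrow> bool" where
  "definable_fun S f \<longleftrightarrow> {vec_list x @ [f x] |x. True} \<in> S (CARD('n::enum) + 1)"

definition definable_setmap :: "(nat \<Rightarrow> real list set set) \<Rightarrow> (real ^ 'n::enum \<Rightarrow> (real ^ 'n::enum) set) \<Rightarrow> bool" where
  "definable_setmap S D \<longleftrightarrow> {vec_list x @ vec_list v |x v. v \<in> D x} \<in> S (CARD('n::enum) + CARD('n::enum))"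

definition definable_real_fun_on :: "(nat \<Rightarrow> real list set set) \<Rightarrow> real set \<Rightarrow> (real \<Rightarrow> real) \<Rightarrow> bool" where
  "definable_real_fun_on S I g \<longleftrightarrow> {[t, g t] |t. t \<in> I} \<in> S 2"

definition abs_cont_on01 :: "(real \<Rightarrow> 'a::real_normed_vector) \<Rightarrow> bool" where
  "abs_cont_on01 \<gamma> \<longleftrightarrow>
    (\<forall>\<epsilon>>0. \<exists>\<delta>>0. \<forall>(n::nat) a b.
       (\<forall>i<n. 0 \<le> a i \<and> a i \<le> b i \<and> b i \<le> 1)
       \<and> (\<forall>i<n. \<forall>j<n. i \<noteq> j \<longrightarrow> b i \<le> a j \<or> b j \<le> a i)
       \<and> (\<Sum>i<n. b i - a i) < \<delta>
       \<longrightarrow> (\<Sum>i<n. norm (\<gamma> (b i) - \<gamma> (a i))) < \<epsilon>)"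

text \<open>The integrand t \<mapsto> max_{v \<in> D(\<gamma> t)} <\<gamma>'(t), v>; on compact nonempty sets Sup = max.\<close>
definition field_integrand :: "(real ^ 'n \<Rightarrow> (real ^ 'n) set) \<Rightarrow> (real \<Rightarrow> real ^ 'n) \<Rightarrow> real \<Rightarrow> real" where
  "field_integrand D \<gamma> t = (SUP v\<in>D (\<gamma> t). inner (vector_derivative \<gamma> (at t within {0..1})) v)"

definition conservative_field :: "(real ^ 'n \<Rightarrow> (real ^ 'n) set) \<Rightarrow> bool" where
  "conservative_field D \<longleftrightarrow>
     closed {(x, v). v \<in> D x}
   \<and> (\<forall>x. D x \<noteq> {} \<and> compact (D x))
   \<and> (\<forall>\<gamma>. abs_cont_on01 \<gamma> \<and> \<gamma> 0 = \<gamma> 1 \<longrightarrow> (field_integrand D \<gamma> has_integral 0) {0..1})"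

definition conservative_field_for :: "(real ^ 'n \<Rightarrow> (real ^ 'n) set) \<Rightarrow> (real ^ 'n \<Rightarrow> real) \<Rightarrow> bool" where
  "conservative_field_for D f \<longleftrightarrow>
     conservative_field D
   \<and> (\<forall>x \<gamma>. abs_cont_on01 \<gamma> \<and> \<gamma> 0 = 0 \<and> \<gamma> 1 = x \<longrightarrow>
          (field_integrand D \<gamma> has_integral (f x - f 0)) {0..1})"

end

theory Submission
  imports Defs
begin

text \<open>The key point is an inequality that needs no restriction on \<open>x\<close> except that \<open>f x\<close> is
  small: for a weight \<open>w x = (1 + \<parallel>x\<parallel>\<^sup>2)\<^sup>2\<close> there is \<open>\<psi>\<close> with \<open>\<parallel>v\<parallel> * w x * \<psi>' \<bar>f x\<bar> \<ge> 1\<close>. To find it,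
  choose definably, for each small \<open>t > 0\<close>, a pair \<open>(\<theta> t, \<nu> t)\<close> in the graph of \<open>D\<close> with
  \<open>\<bar>f (\<theta> t)\<bar> = t\<close> and \<open>\<parallel>\<nu> t\<parallel> * w (\<theta> t)\<close> almost minimal. As \<open>D\<close> is conservative for \<open>f\<close>, the product
  \<open>\<parallel>\<theta>' t\<parallel> * \<parallel>\<nu> t\<parallel>\<close> is bounded below, and \<open>\<parallel>\<theta>' t\<parallel> / w (\<theta> t)\<close> is at most the speed of the curve with
  coordinates \<open>\<theta>\<^sub>k / sqrt (1 + \<theta>\<^sub>k\<^sup>2)\<close>. These coordinates are bounded, definable, and hence monotone
  and \<open>C\<^sup>1\<close> near \<open>0\<close>, so that \<open>\<psi>\<close> may be taken as a combination of them. Finally \<open>sqrt \<psi>\<close> absorbs the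
  weight as long as \<open>\<psi> \<bar>f x\<bar> \<le> 1 / (2 * w x)\<^sup>2\<close>, which is ensured by a suitable \<open>\<kappa>\<close>.

  All the o-minimality that is used concerns germs at \<open>0+\<close> of functions of one real variable.\<close>

section \<open>Definable predicates and functions\<close>

text \<open>Level sets of \<open>f\<close> may be unbounded, so the chosen curve may escape to
  infinity as \<open>t\<close> tends to 0, and the finite length of bounded definable curves cannot
  be applied to it directly; the weight is there to restore it. Its exponent comes from u / sqrt (1
  + u^2): the derivative (1 + u^2)^(-3/2) is at least 1 / (1 + norm(x)^2)^2 when u is a coordinate
  of x. Unboundedness is also why a minimum may fail to exist. The selection is therefore allowed a
  slack t^2, which does no harm because a bounded function cannot have derivative above 1 / (2 t)
  for all small t > 0. A conservative field gives information on integrals only. Pointwise bounds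
  are recovered from o-minimality: a definable condition on t is true for all small t > 0 or false
  for all small t > 0, so it suffices to refute its failure on a whole interval. The bounds carry
  some room so that a uniform constant is available for this refutation.\<close>

lemma rspace_Suc: "z \<in> rspace (Suc n) \<longleftrightarrow> (\<exists>x t. z = x @ [t] \<and> x \<in> rspace n)"
  by (auto simp: rspace_def length_Suc_conv_rev)

locale o_minimal_structure =
  fixes S :: "nat \<Rightarrow> real list set set"
  assumes o_minimal: "o_minimal S"
begin

text \<open>In the rules for quantifiers a bound variable is appended to the context, so that the
  variables of a context \<open>z\<close>, from the innermost one on, are \<open>last z\<close>, \<open>last (butlast z)\<close> and so on.\<close>

definition defpred :: "nat \<Rightarrow> (real list \<Rightarrow> bool) \<Rightarrow> bool" where
  "defpred n P \<longleftrightarrow> {x \<in> rspace n. P x} \<in> S n"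

definition deffun :: "nat \<Rightarrow> (real list \<Rightarrow> real) \<Rightarrow> bool" where
  "deffun n F \<longleftrightarrow> defpred (Suc n) (\<lambda>z. last z = F (butlast z))"

lemma S_empty: "{} \<in> S n"
  and S_Un: "A \<in> S n \<Longrightarrow> B \<in> S n \<Longrightarrow> A \<union> B \<in> S n"
  and S_Compl: "A \<in> S n \<Longrightarrow> rspace n - A \<in> S n"
  and S_poly: "P \<in> poly_fun \<Longrightarrow> {x \<in> rspace n. P x = 0} \<in> S n"
  and S_snoc: "A \<in> S n \<Longrightarrow> {x @ [t] |x t. x \<in> A} \<in> S (Suc n)"
  and S_Cons: "A \<in> S n \<Longrightarrow> {t # x |x t. x \<in> A} \<in> S (Suc n)"
  and S_butlast: "A \<in> S (Suc n) \<Longrightarrow> butlast ` A \<in> S n"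
  and S_1: "A \<in> S 1 \<Longrightarrow> finite_union_intervals {t. [t] \<in> A}"
proof -
  note ax = o_minimal[unfolded o_minimal_def]
  show "{} \<in> S n"
    by (rule ax[THEN conjunct2, THEN conjunct1, rule_format])
  show "A \<in> S n \<Longrightarrow> B \<in> S n \<Longrightarrow> A \<union> B \<in> S n"
    by (rule ax[THEN conjunct2, THEN conjunct2, THEN conjunct1, rule_format])
  show "A \<in> S n \<Longrightarrow> rspace n - A \<in> S n"
    by (rule ax[THEN conjunct2, THEN conjunct2, THEN conjunct2, THEN conjunct1, rule_format])
  show "P \<in> poly_fun \<Longrightarrow> {x \<in> rspace n. P x = 0} \<in> S n"
    by (rule ax[THEN conjunct2, THEN conjunct2, THEN conjunct2, THEN conjunct2, THEN conjunct1, rule_format])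
  show "A \<in> S n \<Longrightarrow> {x @ [t] |x t. x \<in> A} \<in> S (Suc n)"
    by (rule ax[THEN conjunct2, THEN conjunct2, THEN conjunct2, THEN conjunct2, THEN conjunct2, THEN conjunct1, rule_format])
  show "A \<in> S n \<Longrightarrow> {t # x |x t. x \<in> A} \<in> S (Suc n)"
    by (rule ax[THEN conjunct2, THEN conjunct2, THEN conjunct2, THEN conjunct2, THEN conjunct2, THEN conjunct2, THEN conjunct1, rule_format])
  show "A \<in> S (Suc n) \<Longrightarrow> butlast ` A \<in> S n"
    by (rule ax[THEN conjunct2, THEN conjunct2, THEN conjunct2, THEN conjunct2, THEN conjunct2, THEN conjunct2, THEN conjunct2, THEN conjunct1, rule_format])
  show "A \<in> S 1 \<Longrightarrow> finite_union_intervals {t. [t] \<in> A}"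
    by (rule ax[THEN conjunct2, THEN conjunct2, THEN conjunct2, THEN conjunct2, THEN conjunct2, THEN conjunct2, THEN conjunct2, THEN conjunct2, rule_format])
qed

section \<open>Boolean operations and quantifiers\<close>

lemma defpred_cong:
  "(\<And>x. x \<in> rspace n \<Longrightarrow> P x = Q x) \<Longrightarrow> defpred n P \<longleftrightarrow> defpred n Q"
proof -
  assume "\<And>x. x \<in> rspace n \<Longrightarrow> P x = Q x"
  then have "{x \<in> rspace n. P x} = {x \<in> rspace n. Q x}" by (intro Collect_cong conj_cong) auto
  then show ?thesis unfolding defpred_def by (rule arg_cong)
qed

lemma defpred_Suc_cong:
  "(\<And>x t. length x = n \<Longrightarrow> P (x @ [t]) = Q (x @ [t])) \<Longrightarrow> defpred (Suc n) P \<longleftrightarrow> defpred (Suc n) Q"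
  by (rule defpred_cong) (auto simp: rspace_def length_Suc_conv_rev)

lemma deffun_cong:
  assumes "\<And>x. x \<in> rspace n \<Longrightarrow> F x = G x"
  shows "deffun n F \<longleftrightarrow> deffun n G"
  unfolding deffun_def by (rule defpred_cong) (auto simp: rspace_Suc assms)

lemma defpred_not: "defpred n P \<Longrightarrow> defpred n (\<lambda>x. \<not> P x)"
proof -
  assume "defpred n P"
  then have "rspace n - {x \<in> rspace n. P x} \<in> S n"
    unfolding defpred_def by (rule S_Compl)
  moreover have "rspace n - {x \<in> rspace n. P x} = {x \<in> rspace n. \<not> P x}" by blast
  ultimately show ?thesis by (simp add: defpred_def)
qed

lemma defpred_disj: "defpred n P \<Longrightarrow> defpred n Q \<Longrightarrow> defpred n (\<lambda>x. P x \<or> Q x)"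
proof -
  assume "defpred n P" "defpred n Q"
  then have "{x \<in> rspace n. P x} \<union> {x \<in> rspace n. Q x} \<in> S n"
    unfolding defpred_def by (rule S_Un)
  moreover have "{x \<in> rspace n. P x} \<union> {x \<in> rspace n. Q x} = {x \<in> rspace n. P x \<or> Q x}" by blast
  ultimately show ?thesis by (simp add: defpred_def)
qed

lemma defpred_conj: "defpred n P \<Longrightarrow> defpred n Q \<Longrightarrow> defpred n (\<lambda>x. P x \<and> Q x)"
  using defpred_not[OF defpred_disj[OF defpred_not[of n P] defpred_not[of n Q]]] by simp

lemma defpred_imp: "defpred n P \<Longrightarrow> defpred n Q \<Longrightarrow> defpred n (\<lambda>x. P x \<longrightarrow> Q x)"
  unfolding imp_conv_disj by (intro defpred_disj defpred_not)

lemma defpred_poly: "P \<in> poly_fun \<Longrightarrow> defpred n (\<lambda>x. P x = 0)"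
  unfolding defpred_def by (rule S_poly)

lemma defpred_const: "defpred n (\<lambda>x. b)"
proof -
  have "defpred n (\<lambda>x. False)" by (simp add: defpred_def S_empty)
  then show ?thesis using defpred_not[of n "\<lambda>x. False"] by (cases b) auto
qed

lemma defpred_ex:
  assumes "defpred (Suc n) (\<lambda>z. P (butlast z) (last z))"
  shows "defpred n (\<lambda>x. \<exists>t. P x t)"
proof -
  let ?A = "{z \<in> rspace (Suc n). P (butlast z) (last z)}"
  have "butlast ` ?A \<in> S n"
    using assms unfolding defpred_def by (rule S_butlast)
  moreover have "butlast ` ?A = {x \<in> rspace n. \<exists>t. P x t}"
  proof (intro subset_antisym subsetI)
    fix x assume "x \<in> {x \<in> rspace n. \<exists>t. P x t}"
    then obtain t where "x @ [t] \<in> ?A" by (auto simp: rspace_def)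
    then show "x \<in> butlast ` ?A" by (rule rev_image_eqI) simp
  qed (auto simp: rspace_Suc)
  ultimately show ?thesis by (simp add: defpred_def)
qed

lemma defpred_all:
  assumes "defpred (Suc n) (\<lambda>z. P (butlast z) (last z))"
  shows "defpred n (\<lambda>x. \<forall>t. P x t)"
  using defpred_not[OF defpred_ex[OF defpred_not[OF assms]]] by simp

text \<open>The block \<open>y\<close> occupies the last \<open>k\<close> coordinates of the ambient
  point and is projected away one coordinate at a time.\<close>

lemma defpred_ex_list:
  "defpred (n + k) (\<lambda>z. P (take n z) (drop n z)) \<Longrightarrow> defpred n (\<lambda>x. \<exists>y\<in>rspace k. P x y)"
proof (induction k arbitrary: P)
  case 0
  have "defpred n (\<lambda>x. \<exists>y\<in>rspace 0. P x y) \<longleftrightarrow> defpred n (\<lambda>z. P (take n z) (drop n z))"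
    by (rule defpred_cong) (auto simp: rspace_def)
  then show ?case using 0 by simp
next
  case (Suc k)
  have "defpred (Suc (n + k))
      (\<lambda>z. P (take n (butlast z)) (drop n (butlast z) @ [last z]))
    \<longleftrightarrow> defpred (Suc (n + k)) (\<lambda>z. P (take n z) (drop n z))"
    by (rule defpred_Suc_cong) simp
  then have "defpred (n + k) (\<lambda>w. \<exists>t. P (take n w) (drop n w @ [t]))"
    using Suc.prems by (intro defpred_ex) simp
  from Suc.IH[OF this] have "defpred n (\<lambda>x. \<exists>y\<in>rspace k. \<exists>t. P x (y @ [t]))" .
  moreover have "defpred n (\<lambda>x. \<exists>y\<in>rspace k. \<exists>t. P x (y @ [t]))
      \<longleftrightarrow> defpred n (\<lambda>x. \<exists>y\<in>rspace (Suc k). P x y)"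
    by (rule defpred_cong) (metis (no_types, lifting) rspace_Suc)
  ultimately show ?case by simp
qed

lemma defpred_drop: "defpred m P \<Longrightarrow> defpred (n + m) (\<lambda>z. P (drop n z))"
proof (induction n)
  case (Suc n)
  then have "{t # x |x t. x \<in> {z \<in> rspace (n + m). P (drop n z)}} \<in> S (Suc (n + m))"
    unfolding defpred_def by (intro S_Cons) simp
  moreover have "{t # x |x t. x \<in> {z \<in> rspace (n + m). P (drop n z)}}
      = {z \<in> rspace (Suc n + m). P (drop (Suc n) z)}"
    by (auto simp: rspace_def length_Suc_conv)
  ultimately show ?case by (simp add: defpred_def)
qed simp

lemma defpred_ball_less:
  "(\<And>j. j < m \<Longrightarrow> defpred n (P j)) \<Longrightarrow> defpred n (\<lambda>x. \<forall>j<(m::nat). P j x)"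
proof (induction m)
  case (Suc m)
  have "defpred n (\<lambda>x. (\<forall>j<m. P j x) \<and> P m x)"
    using Suc by (intro defpred_conj) auto
  also have "?this \<longleftrightarrow> ?case"
    by (rule defpred_cong) (auto simp: less_Suc_eq)
  finally show ?case .
qed (simp add: defpred_const)

section \<open>Change of coordinates and substitution\<close>

lemma defpred_nth_eq: "defpred n (\<lambda>x. x ! i = x ! j)"
proof -
  have "(\<lambda>x. x ! i + (-1) * x ! j) \<in> poly_fun" by (intro poly_fun.intros)
  from defpred_poly[OF this, of n] show ?thesis by simp
qed

text \<open>The axioms speak of cylinders and of forgetting the last coordinate, not of
  permutations. The selected coordinates are therefore copied to a new block at the end, tied to the
  originals by polynomial equations; \<open>P\<close> is read on the block, and the block is
  quantified away. Repetitions and omissions in \<open>js\<close> are allowed.\<close>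

lemma defpred_reindex:
  assumes P: "defpred (length js) P" and js: "\<And>j. j \<in> set js \<Longrightarrow> j < n"
  shows "defpred n (\<lambda>x. P (map ((!) x) js))"
proof -
  let ?m = "length js"
  have "defpred (n + ?m) (\<lambda>z. P (drop n z) \<and> (\<forall>j<?m. z ! (n + j) = z ! (js ! j)))"
    by (intro defpred_conj defpred_drop P defpred_ball_less defpred_nth_eq)
  also have "?this \<longleftrightarrow> defpred (n + ?m)
      (\<lambda>z. P (drop n z) \<and> (\<forall>j<?m. drop n z ! j = take n z ! (js ! j)))"
    using js by (intro defpred_cong) (auto simp: rspace_def)
  finally have "defpred n (\<lambda>x. \<exists>y\<in>rspace ?m. P y \<and> (\<forall>j<?m. y ! j = x ! (js ! j)))"
    by (rule defpred_ex_list)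
  also have "?this \<longleftrightarrow> defpred n (\<lambda>x. P (map ((!) x) js))"
  proof (rule defpred_cong)
    fix x
    have "y = map ((!) x) js" if "y \<in> rspace ?m" "\<forall>j<?m. y ! j = x ! (js ! j)" for y
      using that by (intro nth_equalityI) (auto simp: rspace_def)
    moreover have "map ((!) x) js \<in> rspace ?m \<and> (\<forall>j<?m. map ((!) x) js ! j = x ! (js ! j))"
      by (simp add: rspace_def)
    ultimately show "(\<exists>y\<in>rspace ?m. P y \<and> (\<forall>j<?m. y ! j = x ! (js ! j))) = P (map ((!) x) js)"
      by blast
  qed
  finally show ?thesis .
qed

text \<open>The copying device of \<open>defpred_reindex\<close> again, with the equations y_j = F_j
  x in place of equalities between coordinates.\<close>

lemma defpred_subst:
  assumes P: "defpred (length Fs) P" and Fs: "\<And>F. F \<in> set Fs \<Longrightarrow> deffun n F"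
  shows "defpred n (\<lambda>x. P (map (\<lambda>F. F x) Fs))"
proof -
  let ?m = "length Fs"
  have graph: "defpred (n + ?m) (\<lambda>z. drop n z ! j = (Fs ! j) (take n z))" if "j < ?m" for j
  proof -
    \<comment> \<open>The graph of the j-th function lives in n + 1 variables: the original point
      and the j-th entry of the appended block.\<close>
    let ?js = "[0..<n] @ [n + j]"
    have "deffun n (Fs ! j)" using Fs that by simp
    then have "defpred (length ?js) (\<lambda>z. last z = (Fs ! j) (butlast z))"
      by (simp add: deffun_def)
    then have "defpred (n + ?m) (\<lambda>z. last (map ((!) z) ?js) = (Fs ! j) (butlast (map ((!) z) ?js)))"
      using that by (intro defpred_reindex) auto
    also have "?this \<longleftrightarrow> ?thesis"
    proof (rule defpred_cong)
      fix z assume z: "z \<in> rspace (n + ?m)"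
      then have "map ((!) z) [0..<n] = take n z"
        by (intro nth_equalityI) (auto simp: rspace_def)
      then show "(last (map ((!) z) ?js) = (Fs ! j) (butlast (map ((!) z) ?js)))
          = (drop n z ! j = (Fs ! j) (take n z))"
        using z by (simp add: rspace_def butlast_append)
    qed
    finally show ?thesis .
  qed
  have "defpred (n + ?m) (\<lambda>z. P (drop n z) \<and> (\<forall>j<?m. drop n z ! j = (Fs ! j) (take n z)))"
    by (intro defpred_conj defpred_drop P defpred_ball_less graph)
  then have "defpred n (\<lambda>x. \<exists>y\<in>rspace ?m. P y \<and> (\<forall>j<?m. y ! j = (Fs ! j) x))"
    by (rule defpred_ex_list)
  also have "?this \<longleftrightarrow> ?thesis"
  proof (rule defpred_cong)
    fix x
    have "y = map (\<lambda>F. F x) Fs" if "y \<in> rspace ?m" "\<forall>j<?m. y ! j = (Fs ! j) x" for y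
      using that by (intro nth_equalityI) (auto simp: rspace_def)
    moreover have "map (\<lambda>F. F x) Fs \<in> rspace ?m \<and> (\<forall>j<?m. map (\<lambda>F. F x) Fs ! j = (Fs ! j) x)"
      by (simp add: rspace_def)
    ultimately show "(\<exists>y\<in>rspace ?m. P y \<and> (\<forall>j<?m. y ! j = (Fs ! j) x)) = P (map (\<lambda>F. F x) Fs)"
      by blast
  qed
  finally show ?thesis .
qed

lemma deffun_nth:
  assumes "i < n"
  shows "deffun n (\<lambda>x. x ! i)"
proof -
  have "defpred (Suc n) (\<lambda>z. z ! n = z ! i)" by (rule defpred_nth_eq)
  also have "?this \<longleftrightarrow> defpred (Suc n) (\<lambda>z. last z = butlast z ! i)"
    using assms by (intro defpred_Suc_cong) (auto simp: nth_append)
  finally show ?thesis by (simp add: deffun_def)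
qed

lemma deffun_last: "deffun (Suc n) last"
proof -
  have "deffun (Suc n) (\<lambda>x. x ! n)" by (rule deffun_nth) simp
  also have "?this \<longleftrightarrow> ?thesis" by (rule deffun_cong) (auto simp: rspace_def length_Suc_conv_rev)
  finally show ?thesis .
qed

lemma deffun_const: "deffun n (\<lambda>x. c)"
proof -
  have "(\<lambda>x. x ! n + (- c)) \<in> poly_fun" by (intro poly_fun.intros)
  from defpred_poly[OF this, of "Suc n"] have "defpred (Suc n) (\<lambda>z. z ! n = c)" by simp
  also have "?this \<longleftrightarrow> defpred (Suc n) (\<lambda>z. last z = c)"
    by (intro defpred_Suc_cong) auto
  finally show ?thesis by (simp add: deffun_def)
qed

lemma deffun_butlast:
  assumes "deffun n F"
  shows "deffun (Suc n) (\<lambda>z. F (butlast z))"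
proof -
  \<comment> \<open>In a point \<open>x @ [s, t]\<close> the graph of \<open>F\<close> concerns only
    \<open>x\<close> and the value \<open>t\<close>, so position \<open>n\<close> is
    skipped.\<close>
  let ?js = "[0..<n] @ [Suc n]"
  have "defpred (length ?js) (\<lambda>z. last z = F (butlast z))"
    using assms by (simp add: deffun_def)
  then have "defpred (Suc (Suc n)) (\<lambda>z. last (map ((!) z) ?js) = F (butlast (map ((!) z) ?js)))"
    by (intro defpred_reindex) auto
  also have "?this \<longleftrightarrow> defpred (Suc (Suc n)) (\<lambda>z. last z = F (butlast (butlast z)))"
  proof (rule defpred_cong)
    fix z assume "z \<in> rspace (Suc (Suc n))"
    then obtain x s t where z: "z = (x @ [s]) @ [t]" "length x = n"
      by (auto simp: rspace_Suc) (auto simp: rspace_def)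
    then have "map ((!) z) [0..<n] = x"
      by (intro nth_equalityI) (auto simp: nth_append)
    then show "(last (map ((!) z) ?js) = F (butlast (map ((!) z) ?js)))
        = (last z = F (butlast (butlast z)))"
      using z by (simp add: butlast_append nth_append)
  qed
  finally show ?thesis by (simp add: deffun_def)
qed

lemma deffun_comp:
  assumes G: "deffun (length Fs) G" and Fs: "\<And>F. F \<in> set Fs \<Longrightarrow> deffun n F"
  shows "deffun n (\<lambda>x. G (map (\<lambda>F. F x) Fs))"
proof -
  \<comment> \<open>The graph of the composition is the graph of \<open>G\<close> pulled back along
    these maps: the inner functions ignore the value coordinate and \<open>last\<close> passes it
    on.\<close>
  let ?Hs = "map (\<lambda>F z. F (butlast z)) Fs @ [last]"
  have "defpred (length ?Hs) (\<lambda>z. last z = G (butlast z))"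
    using G by (simp add: deffun_def)
  then have "defpred (Suc n) (\<lambda>z. last (map (\<lambda>F. F z) ?Hs) = G (butlast (map (\<lambda>F. F z) ?Hs)))"
    using Fs by (intro defpred_subst) (auto intro: deffun_butlast deffun_last)
  then show ?thesis by (simp add: deffun_def butlast_append comp_def)
qed

text \<open>Turns a first-order characterisation of the value into definability of the function.
  Roots, suprema, right derivatives and an inverse function are all treated in this way.\<close>

lemma deffun_description:
  assumes "defpred (Suc n) (\<lambda>z. P (butlast z) (last z))"
    and "\<And>x r. x \<in> rspace n \<Longrightarrow> r = F x \<longleftrightarrow> P x r"
  shows "deffun n F"
proof -
  have "defpred (Suc n) (\<lambda>z. last z = F (butlast z))
      \<longleftrightarrow> defpred (Suc n) (\<lambda>z. P (butlast z) (last z))"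
    using assms(2) by (intro defpred_cong) (auto simp: rspace_Suc)
  then show ?thesis using assms(1) by (simp add: deffun_def)
qed

lemma defpred_rel2:
  assumes "defpred (Suc (Suc 0)) (\<lambda>z. R (last (butlast z)) (last z))"
    and "deffun n F" "deffun n G"
  shows "defpred n (\<lambda>x. R (F x) (G x))"
  using defpred_subst[of "[F, G]" "\<lambda>z. R (last (butlast z)) (last z)" n] assms by auto

lemma defpred_rel1:
  assumes "defpred (Suc 0) (\<lambda>z. R (last z))" and "deffun n F"
  shows "defpred n (\<lambda>x. R (F x))"
  using defpred_subst[of "[F]" "\<lambda>z. R (last z)" n] assms by auto

lemma deffun_fun2:
  assumes "deffun (Suc (Suc 0)) (\<lambda>z. g (last (butlast z)) (last z))"
    and "deffun n F" "deffun n G"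
  shows "deffun n (\<lambda>x. g (F x) (G x))"
  using deffun_comp[of "[F, G]" "\<lambda>z. g (last (butlast z)) (last z)" n] assms by auto

lemma deffun_fun1:
  assumes "deffun (Suc 0) (\<lambda>z. g (last z))" and "deffun n F"
  shows "deffun n (\<lambda>x. g (F x))"
  using deffun_comp[of "[F]" "\<lambda>z. g (last z)" n] assms by auto

section \<open>Arithmetic, order and case distinction\<close>

lemma rspace_3: "z \<in> rspace (Suc (Suc (Suc 0))) \<longleftrightarrow> (\<exists>a b c. z = [a, b, c])"
  by (auto simp: rspace_def length_Suc_conv)

lemma rspace_2: "z \<in> rspace (Suc (Suc 0)) \<longleftrightarrow> (\<exists>a b. z = [a, b])"
  by (auto simp: rspace_def length_Suc_conv)

lemma deffun_add:
  assumes "deffun n F" "deffun n G"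
  shows "deffun n (\<lambda>x. F x + G x)"
proof -
  have "(\<lambda>x. x ! 0 + x ! 1 + (-1) * x ! 2) \<in> poly_fun" by (intro poly_fun.intros)
  from defpred_poly[OF this, of "Suc (Suc (Suc 0))"]
  have "deffun (Suc (Suc 0)) (\<lambda>z. last (butlast z) + last z)"
    unfolding deffun_def by (rule defpred_cong[THEN iffD1, rotated]) (auto simp: rspace_3)
  from deffun_fun2[OF this assms] show ?thesis .
qed

lemma deffun_mult:
  assumes "deffun n F" "deffun n G"
  shows "deffun n (\<lambda>x. F x * G x)"
proof -
  have "(\<lambda>x. x ! 0 * x ! 1 + (-1) * x ! 2) \<in> poly_fun" by (intro poly_fun.intros)
  from defpred_poly[OF this, of "Suc (Suc (Suc 0))"]
  have "deffun (Suc (Suc 0)) (\<lambda>z. last (butlast z) * last z)"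
    unfolding deffun_def by (rule defpred_cong[THEN iffD1, rotated]) (auto simp: rspace_3)
  from deffun_fun2[OF this assms] show ?thesis .
qed

lemma deffun_uminus: "deffun n F \<Longrightarrow> deffun n (\<lambda>x. - F x)"
  using deffun_mult[OF deffun_const[of n "-1"], of F] by simp

lemma deffun_diff: "deffun n F \<Longrightarrow> deffun n G \<Longrightarrow> deffun n (\<lambda>x. F x - G x)"
  using deffun_add[OF _ deffun_uminus[of n G], of F] by simp

lemma deffun_power: "deffun n F \<Longrightarrow> deffun n (\<lambda>x. F x ^ k)"
  by (induction k) (auto intro: deffun_const deffun_mult)

lemma deffun_sum:
  "(\<And>i. i \<in> I \<Longrightarrow> deffun n (F i)) \<Longrightarrow> deffun n (\<lambda>x. \<Sum>i\<in>I. F i x)"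
  by (induction I rule: infinite_finite_induct) (auto intro: deffun_const deffun_add)

lemma defpred_eq:
  assumes "deffun n F" "deffun n G"
  shows "defpred n (\<lambda>x. F x = G x)"
proof -
  have "defpred (Suc (Suc 0)) (\<lambda>z. last (butlast z) = last z)"
    using defpred_nth_eq[of "Suc (Suc 0)" 0 1]
    by (rule defpred_cong[THEN iffD1, rotated]) (auto simp: rspace_2)
  from defpred_rel2[OF this assms] show ?thesis .
qed

lemma defpred_less:
  assumes "deffun n F" "deffun n G"
  shows "defpred n (\<lambda>x. F x < G x)"
proof -
  \<comment> \<open>The order is obtained from algebra: \<open>b - a\<close> is positive exactly
    when it is the reciprocal of a square, which is one polynomial equation followed by one
    projection.\<close>
  have *: "a < b \<longleftrightarrow> (\<exists>t. (b - a) * t\<^sup>2 = 1)" for a b :: real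
  proof
    assume "a < b"
    then show "\<exists>t. (b - a) * t\<^sup>2 = 1"
      by (intro exI[of _ "1 / sqrt (b - a)"]) (simp add: power_divide)
  next
    assume "\<exists>t. (b - a) * t\<^sup>2 = 1"
    then obtain t where t: "(b - a) * t\<^sup>2 = 1" by blast
    show "a < b"
    proof (rule ccontr)
      assume "\<not> a < b"
      then have "(b - a) * t\<^sup>2 \<le> 0" by (intro mult_nonpos_nonneg) auto
      then show False using t by simp
    qed
  qed
  show ?thesis unfolding *
    by (intro defpred_ex defpred_eq deffun_mult deffun_diff deffun_power deffun_const
        deffun_butlast deffun_last assms)
qed

lemma defpred_le: "deffun n F \<Longrightarrow> deffun n G \<Longrightarrow> defpred n (\<lambda>x. F x \<le> G x)"
  using defpred_not[OF defpred_less[of n G F]] by (simp add: not_less)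

lemma deffun_if:
  assumes "defpred n P" "deffun n F" "deffun n G"
  shows "deffun n (\<lambda>x. if P x then F x else G x)"
proof -
  have p: "defpred (Suc n) (\<lambda>z. P (butlast z))"
  proof -
    have "{x @ [t] |x t. x \<in> {x \<in> rspace n. P x}} \<in> S (Suc n)"
      using assms(1) unfolding defpred_def by (rule S_snoc)
    moreover have "{x @ [t] |x t. x \<in> {x \<in> rspace n. P x}} = {z \<in> rspace (Suc n). P (butlast z)}"
      by (auto simp: rspace_Suc)
    ultimately show ?thesis by (simp add: defpred_def)
  qed
  show ?thesis
    by (rule deffun_description[where P = "\<lambda>x r. (P x \<and> r = F x) \<or> (\<not> P x \<and> r = G x)"])
      (auto intro!: defpred_disj defpred_conj defpred_not defpred_eq p deffun_last
        deffun_butlast assms)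
qed

lemma deffun_abs: "deffun n F \<Longrightarrow> deffun n (\<lambda>x. \<bar>F x\<bar>)"
  unfolding abs_if by (intro deffun_if defpred_less deffun_const deffun_uminus)

lemma deffun_divide:
  assumes "deffun n F" "deffun n G"
  shows "deffun n (\<lambda>x. F x / G x)"
proof -
  \<comment> \<open>Division is total, so the value 0 at a zero denominator belongs to the
    graph.\<close>
  have *: "r = a / b \<longleftrightarrow> (b = 0 \<and> r = 0) \<or> (b \<noteq> 0 \<and> r * b = a)" for a b r :: real
    by (cases "b = 0") (auto simp: nonzero_eq_divide_eq)
  show ?thesis
    unfolding deffun_def *
    by (intro defpred_disj defpred_conj defpred_not defpred_eq deffun_last
      deffun_butlast assms deffun_mult deffun_const)
qed

text \<open>On negative reals \<open>sqrt\<close> is negative, so the description of the root as the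
  nonnegative number with the given square is applied to an absolute value.\<close>

lemma deffun_sqrt_abs:
  assumes "deffun n F"
  shows "deffun n (\<lambda>x. sqrt \<bar>F x\<bar>)"
  by (rule deffun_description[where P = "\<lambda>x r. 0 \<le> r \<and> r ^ 2 = \<bar>F x\<bar>"])
    (intro defpred_conj defpred_le defpred_eq deffun_last deffun_butlast assms deffun_power
      deffun_const deffun_abs, auto intro: real_sqrt_unique[symmetric])

lemmas deffun_arith = deffun_add deffun_diff deffun_uminus deffun_mult deffun_divide deffun_power
  deffun_abs deffun_const deffun_last

lemmas definability = defpred_conj defpred_disj defpred_imp defpred_not defpred_ex defpred_all
  defpred_less defpred_le defpred_eq deffun_arith

abbreviation definable1 :: "(real \<Rightarrow> real) \<Rightarrow> bool" where
  "definable1 g \<equiv> deffun (Suc 0) (\<lambda>z. g (last z))"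

abbreviation defset :: "(real \<Rightarrow> bool) \<Rightarrow> bool" where
  "defset P \<equiv> defpred (Suc 0) (\<lambda>z. P (last z))"

end

section \<open>Germs of definable functions of one variable\<close>

text \<open>An interval that meets every (0, b) contains (0, p) for each positive point p of it, by
  convexity. Any other interval misses some (0, b), and finitely many such neighbourhoods have a
  common one.\<close>

lemma finite_union_intervals_germ:
  assumes "finite_union_intervals U"
  shows "(\<forall>\<^sub>F t in at_right 0. t \<in> U) \<or> (\<forall>\<^sub>F t in at_right 0. t \<notin> U)"
proof -
  obtain F where F: "finite F" "\<And>I. I \<in> F \<Longrightarrow> is_interval I" "U = \<Union>F"
    using assms unfolding finite_union_intervals_def by blast
  have I: "(\<forall>\<^sub>F t in at_right 0. t \<in> I) \<or> (\<forall>\<^sub>F t in at_right 0. t \<notin> I)"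
    if "is_interval I" for I :: "real set"
  proof (rule disjCI)
    assume "\<not> (\<forall>\<^sub>F t in at_right 0. t \<notin> I)"
    then have *: "\<exists>t>0. t < b \<and> t \<in> I" if "b > 0" for b
      using that by (auto simp: eventually_at_right_field)
    then obtain p where p: "p > 0" "p \<in> I" using zero_less_one by blast
    have "t \<in> I" if "0 < t" "t < p" for t
      using *[OF that(1)] p that \<open>is_interval I\<close> unfolding is_interval_1 by (meson less_imp_le)
    then show "\<forall>\<^sub>F t in at_right 0. t \<in> I"
      using p(1) by (auto simp: eventually_at_right_field)
  qed
  show ?thesis
  proof (cases "\<exists>I\<in>F. \<forall>\<^sub>F t in at_right 0. t \<in> I")
    case True
    then obtain I where "I \<in> F" "\<forall>\<^sub>F t in at_right 0. t \<in> I" by blast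
    then have "\<forall>\<^sub>F t in at_right 0. t \<in> U"
      using F(3) by (auto elim: eventually_mono)
    then show ?thesis ..
  next
    case False
    then have "\<forall>\<^sub>F t in at_right 0. \<forall>I\<in>F. t \<notin> I"
      using I F(1,2) by (intro eventually_ball_finite) auto
    then show ?thesis using F(3) by simp
  qed
qed

text \<open>Real induction: at the supremum \<open>s\<close> of the points up to which
  \<open>g a\<close> is a lower bound, \<open>left\<close> reaches \<open>s\<close>, and
  \<open>right\<close> pushes beyond it unless \<open>s = b\<close>. Two one-sided conditions
  replace continuity, so that the lemma applies to functions not yet known to be continuous.\<close>

lemma le_of_local_le:
  fixes g :: "real \<Rightarrow> real"
  assumes "a \<le> b"
    and right: "\<And>x. a \<le> x \<Longrightarrow> x < b \<Longrightarrow> \<forall>\<^sub>F y in at_right x. g x \<le> g y"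
    and left: "\<And>x c. a < x \<Longrightarrow> x \<le> b \<Longrightarrow> \<forall>y. a \<le> y \<and> y < x \<longrightarrow> c \<le> g y \<Longrightarrow> c \<le> g x"
  shows "g a \<le> g b"
proof -
  define X where "X = {y. a \<le> y \<and> y \<le> b \<and> (\<forall>u. a \<le> u \<and> u \<le> y \<longrightarrow> g a \<le> g u)}"
  define s where "s = Sup X"
  have aX: "a \<in> X" using assms(1) by (auto simp: X_def)
  have bdd: "bdd_above X" by (auto simp: X_def bdd_above_def)
  have s: "a \<le> s" "s \<le> b"
    using aX bdd by (auto simp: s_def X_def intro: cSup_upper cSup_least)
  have below: "g a \<le> g u" if "a \<le> u" "u < s" for u
  proof -
    have "X \<noteq> {}" using aX by blast
    from less_cSupD[OF this that(2)[unfolded s_def]] obtain y where "y \<in> X" "u < y" by blast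
    then show ?thesis using that by (auto simp: X_def)
  qed
  have gs: "g a \<le> g s"
    using s below left[of s "g a"] by (cases "a = s") auto
  have "s = b"
  proof (rule ccontr)
    assume "s \<noteq> b"
    then have "s < b" using s by simp
    from right[OF s(1) this] obtain c where c: "c > s" "\<And>y. s < y \<Longrightarrow> y < c \<Longrightarrow> g s \<le> g y"
      by (auto simp: eventually_at_right_field)
    define y where "y = (s + min c b) / 2"
    have y: "s < y" "y < c" "y < b" using c(1) \<open>s < b\<close> by (auto simp: y_def)
    have "g a \<le> g u" if "a \<le> u" "u \<le> y" for u
      using below[of u] gs c(2)[of u] that y by (cases u s rule: linorder_cases) auto
    then have "y \<in> X" using s y by (auto simp: X_def)
    then show False using cSup_upper[OF _ bdd] y(1) by (force simp: s_def)
  qed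
  then show ?thesis using gs by simp
qed

text \<open>A strict local minimum lies strictly below all other values on some interval with
  rational end points. Two points sharing this interval would each lie strictly below the other, so
  the interval determines the point.\<close>

lemma countable_strict_local_minima:
  fixes g :: "real \<Rightarrow> real"
  shows "countable {x. \<exists>d>0. \<forall>y. y \<noteq> x \<and> \<bar>y - x\<bar> < d \<longrightarrow> g x < g y}"
proof -
  let ?M = "{x. \<exists>d>0. \<forall>y. y \<noteq> x \<and> \<bar>y - x\<bar> < d \<longrightarrow> g x < g y}"
  have "\<forall>x\<in>?M. \<exists>w. w \<in> \<rat> \<times> \<rat> \<and> fst w < x \<and> x < snd w \<and>
      (\<forall>y. y \<noteq> x \<and> fst w < y \<and> y < snd w \<longrightarrow> g x < g y)"
  proof
    fix x assume "x \<in> ?M"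
    then obtain d where d: "d > 0" "\<And>y. y \<noteq> x \<Longrightarrow> \<bar>y - x\<bar> < d \<Longrightarrow> g x < g y" by auto
    obtain p where p: "p \<in> \<rat>" "x - d < p" "p < x" using Rats_dense_in_real[of "x - d" x] d(1) by auto
    obtain q where q: "q \<in> \<rat>" "x < q" "q < x + d" using Rats_dense_in_real[of x "x + d"] d(1) by auto
    have "g x < g y" if "y \<noteq> x" "p < y" "y < q" for y
      using that p q by (intro d(2)) auto
    then show "\<exists>w. w \<in> \<rat> \<times> \<rat> \<and> fst w < x \<and> x < snd w \<and>
        (\<forall>y. y \<noteq> x \<and> fst w < y \<and> y < snd w \<longrightarrow> g x < g y)"
      using p q by (intro exI[of _ "(p, q)"]) simp
  qed
  from bchoice[OF this] obtain w where w: "\<And>x. x \<in> ?M \<Longrightarrow> w x \<in> \<rat> \<times> \<rat> \<and> fst (w x) < x \<and> x < snd (w x) \<and>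
      (\<forall>y. y \<noteq> x \<and> fst (w x) < y \<and> y < snd (w x) \<longrightarrow> g x < g y)"
    by blast
  have "inj_on w ?M"
  proof (rule inj_onI, rule ccontr)
    fix x y assume xy: "x \<in> ?M" "y \<in> ?M" "w x = w y" "x \<noteq> y"
    have "g x < g y" using w[OF xy(1)] w[OF xy(2)] xy(3,4) by simp
    moreover have "g y < g x" using w[OF xy(1)] w[OF xy(2)] xy(3,4) by simp
    ultimately show False by simp
  qed
  moreover have "w ` ?M \<subseteq> \<rat> \<times> \<rat>" using w by (intro image_subsetI) blast
  then have "countable (w ` ?M)"
    by (rule countable_subset) (intro countable_SIGMA countable_rat)
  ultimately show ?thesis by (rule countable_image_inj_on[rotated])
qed

text \<open>The limit is the infimum. The conclusion is spelled out with quantifiers over reals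
  because limits are shown definable in this form.\<close>

lemma mono_bounded_below_limit:
  fixes u :: "real \<Rightarrow> real"
  assumes "d > 0" and mono: "mono_on {0<..<d} u" and m: "\<And>h. 0 < h \<Longrightarrow> h < d \<Longrightarrow> m \<le> u h"
  shows "\<exists>r. \<forall>e>0. \<exists>\<delta>>0. \<forall>h. 0 < h \<and> h < \<delta> \<longrightarrow> \<bar>u h - r\<bar> < e"
proof (rule exI[of _ "Inf (u ` {0<..<d})"], intro allI impI)
  let ?r = "Inf (u ` {0<..<d})"
  fix e :: real assume "e > 0"
  have ne: "u ` {0<..<d} \<noteq> {}" using assms(1) by simp
  have bdd: "bdd_below (u ` {0<..<d})" using m by (intro bdd_belowI2[where m = m]) auto
  from \<open>e > 0\<close> have "?r < ?r + e" by simp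
  then obtain k where k: "0 < k" "k < d" "u k < ?r + e"
    unfolding cInf_less_iff[OF ne bdd] by auto
  have "\<bar>u h - ?r\<bar> < e" if "0 < h" "h < k" for h
  proof -
    have "u h \<le> u k" using mono that k by (auto simp: mono_on_def)
    moreover have "?r \<le> u h" using that k bdd by (intro cInf_lower) auto
    ultimately show ?thesis using k(3) by simp
  qed
  then show "\<exists>\<delta>>0. \<forall>h. 0 < h \<and> h < \<delta> \<longrightarrow> \<bar>u h - ?r\<bar> < e" using k(1) by blast
qed

context o_minimal_structure
begin

section \<open>Eventual truth, monotonicity and continuity\<close>

lemma defset_germ_0:
  assumes "defset P"
  shows "(\<forall>\<^sub>F t in at_right 0. P t) \<or> (\<forall>\<^sub>F t in at_right 0. \<not> P t)"
proof -
  have "finite_union_intervals {t. [t] \<in> {z \<in> rspace 1. P (last z)}}"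
    using assms by (intro S_1) (simp add: defpred_def)
  then show ?thesis using finite_union_intervals_germ by (force simp: rspace_def)
qed

lemma defset_germ_right:
  assumes "defset P"
  shows "(\<forall>\<^sub>F t in at_right a. P t) \<or> (\<forall>\<^sub>F t in at_right a. \<not> P t)"
proof -
  have "defset (\<lambda>t. P (t + a))"
    by (intro defpred_rel1[OF assms] definability)
  from defset_germ_0[OF this] show ?thesis
    by (subst (1 2) eventually_at_right_to_0)
qed

lemma defset_germ_left:
  assumes "defset P"
  shows "(\<forall>\<^sub>F t in at_left a. P t) \<or> (\<forall>\<^sub>F t in at_left a. \<not> P t)"
proof -
  have "defset (\<lambda>t. P (- t))"
    by (intro defpred_rel1[OF assms] definability)
  from defset_germ_right[OF this] show ?thesis
    by (subst (1 2) eventually_at_left_to_right)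
qed

lemma defset_germ_constant:
  assumes "defset P"
  obtains b where "\<forall>\<^sub>F t in at_right 0. P t = b"
  using defset_germ_0[OF assms] that[of True] that[of False] by auto

text \<open>Each of the four one-sided comparisons \<open>A\<close>, \<open>B\<close>,
  \<open>C\<close>, \<open>E\<close> has a constant truth value near 0. Compatible values on the two
  sides give monotonicity. Any other combination makes all points of an interval strict local
  minima, or all of them strict local maxima, although such points are countable.\<close>

lemma definable1_germ_mono:
  assumes g: "definable1 g"
  shows "\<exists>d>0. mono_on {0<..<d} g \<or> mono_on {0<..<d} (\<lambda>x. - g x)"
proof -
  note gd = deffun_fun1[OF g]
  define A where "A x \<longleftrightarrow> (\<forall>\<^sub>F y in at_right x. g x \<le> g y)" for x
  define B where "B x \<longleftrightarrow> (\<forall>\<^sub>F y in at_right x. g y \<le> g x)" for x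
  define C where "C x \<longleftrightarrow> (\<forall>\<^sub>F y in at_left x. g y \<le> g x)" for x
  define E where "E x \<longleftrightarrow> (\<forall>\<^sub>F y in at_left x. g x \<le> g y)" for x
  have dfs: "defset A" "defset B" "defset C" "defset E"
    unfolding A_def B_def C_def E_def eventually_at_right_field eventually_at_left_field
    by (intro definability gd deffun_butlast)+
  obtain a where a: "\<forall>\<^sub>F x in at_right 0. A x = a" by (rule defset_germ_constant[OF dfs(1)])
  obtain b where b: "\<forall>\<^sub>F x in at_right 0. B x = b" by (rule defset_germ_constant[OF dfs(2)])
  obtain c where c: "\<forall>\<^sub>F x in at_right 0. C x = c" by (rule defset_germ_constant[OF dfs(3)])
  obtain e where e: "\<forall>\<^sub>F x in at_right 0. E x = e" by (rule defset_germ_constant[OF dfs(4)])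
  from a b c e have "\<forall>\<^sub>F x in at_right 0. A x = a \<and> B x = b \<and> C x = c \<and> E x = e"
    by (intro eventually_conj)
  then obtain d where d: "d > 0"
    and abce: "\<And>x. 0 < x \<Longrightarrow> x < d \<Longrightarrow> A x = a \<and> B x = b \<and> C x = c \<and> E x = e"
    by (auto simp: eventually_at_right_field)
  have monoI: "mono_on {0<..<d} k"
    if R: "\<And>x. 0 < x \<Longrightarrow> x < d \<Longrightarrow> \<forall>\<^sub>F y in at_right x. k x \<le> k y"
      and L: "\<And>x. 0 < x \<Longrightarrow> x < d \<Longrightarrow> \<forall>\<^sub>F y in at_left x. k y \<le> k x" for k :: "real \<Rightarrow> real"
  proof (rule mono_onI)
    fix r s assume rs: "r \<in> {0<..<d}" "s \<in> {0<..<d}" "r \<le> s"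
    show "k r \<le> k s"
    proof (rule le_of_local_le[OF rs(3)])
      fix x c assume x: "r < x" "x \<le> s" "\<forall>y. r \<le> y \<and> y < x \<longrightarrow> c \<le> k y"
      then obtain w where w: "w < x" "\<And>y. w < y \<Longrightarrow> y < x \<Longrightarrow> k y \<le> k x"
        using L[of x] rs by (auto simp: eventually_at_left_field)
      obtain y where "max r w < y" "y < x" using dense[of "max r w" x] x w by auto
      then have "k y \<le> k x" "c \<le> k y" using w x by auto
      then show "c \<le> k x" by simp
    qed (use R rs in auto)
  qed
  have strict_min_everywhere: False
    if R: "\<And>x. 0 < x \<Longrightarrow> x < d \<Longrightarrow> \<forall>\<^sub>F y in at_right x. k x < k y"
      and L: "\<And>x. 0 < x \<Longrightarrow> x < d \<Longrightarrow> \<forall>\<^sub>F y in at_left x. k x < k y" for k :: "real \<Rightarrow> real"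
  proof -
    have "\<exists>d>0. \<forall>y. y \<noteq> x \<and> \<bar>y - x\<bar> < d \<longrightarrow> k x < k y" if "0 < x" "x < d" for x
    proof -
      have "\<forall>\<^sub>F y in at x. k x < k y"
        using R[OF that] L[OF that] by (simp add: eventually_at_split)
      then show ?thesis by (auto simp: eventually_at dist_real_def)
    qed
    then have "{0<..<d} \<subseteq> {x. \<exists>d>0. \<forall>y. y \<noteq> x \<and> \<bar>y - x\<bar> < d \<longrightarrow> k x < k y}" by auto
    then have "countable {0<..<d}"
      using countable_strict_local_minima countable_subset by blast
    then show False using d uncountable_open_interval by blast
  qed
  have dge: "defset (\<lambda>y. g x \<le> g y)" and dle: "defset (\<lambda>y. g y \<le> g x)" for x
    by (intro definability gd)+
  have nA: "\<forall>\<^sub>F y in at_right x. g y < g x" if "\<not> A x" for x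
    using defset_germ_right[OF dge[of x], of x] that by (simp add: A_def not_le)
  have nB: "\<forall>\<^sub>F y in at_right x. g x < g y" if "\<not> B x" for x
    using defset_germ_right[OF dle[of x], of x] that by (simp add: B_def not_le)
  have nC: "\<forall>\<^sub>F y in at_left x. g x < g y" if "\<not> C x" for x
    using defset_germ_left[OF dle[of x], of x] that by (simp add: C_def not_le)
  have nE: "\<forall>\<^sub>F y in at_left x. g y < g x" if "\<not> E x" for x
    using defset_germ_left[OF dge[of x], of x] that by (simp add: E_def not_le)
  have ab: "a \<or> b"
  proof (rule ccontr)
    assume "\<not> (a \<or> b)"
    then have "\<not> A (d/2)" "\<not> B (d/2)" using abce[of "d/2"] d by auto
    moreover from nA[OF this(1)] have "B (d/2)"
      unfolding B_def by (rule eventually_mono) simp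
    ultimately show False by blast
  qed
  have ce: "c \<or> e"
  proof (rule ccontr)
    assume "\<not> (c \<or> e)"
    then have "\<not> C (d/2)" "\<not> E (d/2)" using abce[of "d/2"] d by auto
    moreover from nC[OF this(1)] have "E (d/2)"
      unfolding E_def by (rule eventually_mono) simp
    ultimately show False by blast
  qed
  consider "a" "c" | "b" "e" | "\<not> b" "\<not> c" | "\<not> a" "\<not> e" using ab ce by blast
  then show ?thesis
  proof cases
    case 1
    then have "mono_on {0<..<d} g"
      using abce by (intro monoI) (auto simp: A_def C_def)
    then show ?thesis using d by blast
  next
    case 2
    then have "mono_on {0<..<d} (\<lambda>x. - g x)"
      using abce by (intro monoI) (auto simp: B_def E_def)
    then show ?thesis using d by blast
  next
    case 3
    then have False
      using abce nB nC by (intro strict_min_everywhere[of g]) auto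
    then show ?thesis ..
  next
    case 4
    then have False
      using abce nA nE by (intro strict_min_everywhere[of "\<lambda>x. - g x"]) auto
    then show ?thesis ..
  qed
qed

text \<open>A monotone function has countably many discontinuities, whereas by the germ dichotomy
  discontinuity arbitrarily close to 0 would fill an interval.\<close>

lemma definable1_germ_continuous:
  assumes g: "definable1 g"
  shows "\<exists>d>0. \<forall>x. 0 < x \<and> x < d \<longrightarrow> isCont g x"
proof -
  obtain d where d: "d > 0" "mono_on {0<..<d} g \<or> mono_on {0<..<d} (\<lambda>x. - g x)"
    using definable1_germ_mono[OF g] by blast
  have "countable {x\<in>{0<..<d}. \<not> isCont g x}"
    using d(2)
  proof
    assume "mono_on {0<..<d} (\<lambda>x. - g x)"
    then have "countable {x\<in>{0<..<d}. \<not> isCont (\<lambda>x. - g x) x}"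
      by (rule mono_on_ctble_discont_open[rotated]) simp
    then show ?thesis
      by (rule countable_subset[rotated]) (auto dest: continuous_minus)
  qed (rule mono_on_ctble_discont_open, simp_all)
  have "defset (\<lambda>x. isCont g x)"
    unfolding continuous_at_real_range real_norm_def
    by (intro definability deffun_fun1[OF g] deffun_butlast)
  from defset_germ_0[OF this] show ?thesis
  proof
    assume "\<forall>\<^sub>F x in at_right 0. \<not> isCont g x"
    then obtain d' where d': "d' > 0" "\<And>x. 0 < x \<Longrightarrow> x < d' \<Longrightarrow> \<not> isCont g x"
      by (auto simp: eventually_at_right_field)
    then have "{0<..<min d d'} \<subseteq> {x\<in>{0<..<d}. \<not> isCont g x}" by auto
    then have "countable {0<..<min d d'}"
      using \<open>countable {x\<in>{0<..<d}. \<not> isCont g x}\<close> countable_subset by blast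
    then show ?thesis using d d' uncountable_open_interval[of 0 "min d d'"] by auto
  qed (auto simp: eventually_at_right_field)
qed

section \<open>Differentiability of definable functions near 0\<close>

lemma le_of_right_slope:
  fixes g :: "real \<Rightarrow> real"
  assumes "a \<le> b" and cont: "\<And>x. a \<le> x \<Longrightarrow> x \<le> b \<Longrightarrow> isCont g x"
    and slope: "\<And>x. a \<le> x \<Longrightarrow> x < b \<Longrightarrow> \<exists>d>0. \<forall>h. 0 < h \<and> h < d \<longrightarrow> C \<le> (g (x + h) - g x) / h"
  shows "C * (b - a) \<le> g b - g a"
proof -
  have "g a - C * a \<le> g b - C * b"
  proof (rule le_of_local_le[OF assms(1)])
    fix x assume "a \<le> x" "x < b"
    from slope[OF this] obtain d where d: "d > 0" "\<And>h. 0 < h \<Longrightarrow> h < d \<Longrightarrow> C \<le> (g (x + h) - g x) / h"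
      by blast
    have "g x - C * x \<le> g y - C * y" if "x < y" "y < x + d" for y
      using d(2)[of "y - x"] that by (simp add: pos_le_divide_eq algebra_simps)
    then show "\<forall>\<^sub>F y in at_right x. g x - C * x \<le> g y - C * y"
      unfolding eventually_at_right_field using d(1) by (intro exI[of _ "x + d"]) auto
  next
    fix x c assume x: "a < x" "x \<le> b" "\<forall>y. a \<le> y \<and> y < x \<longrightarrow> c \<le> g y - C * y"
    have "((\<lambda>y. g y - C * y) \<longlongrightarrow> g x - C * x) (at_left x)"
      using cont[of x] x by (intro tendsto_intros) (auto simp: isCont_def filterlim_at_split)
    moreover have "\<forall>\<^sub>F y in at_left x. c \<le> g y - C * y"
      unfolding eventually_at_left_field using x by (intro exI[of _ a]) auto
    ultimately show "c \<le> g x - C * x"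
      by (intro tendsto_lowerbound) auto
  qed
  then show ?thesis by (simp add: algebra_simps)
qed

text \<open>\<open>R\<close> is the right derivative. The difference quotient at \<open>x\<close> is
  definable in \<open>h\<close>, hence monotone near 0, so it converges or tends to infinity; since
  \<open>g\<close> is increasing it stays nonnegative. Infinite right derivatives on an interval
  contradict the mean value inequality \<open>le_of_right_slope\<close>. Where the right derivative
  is continuous, the same inequality for \<open>g\<close> and for \<open>- g\<close> upgrades it to
  a two-sided derivative.\<close>

lemma definable1_germ_deriv_mono:
  assumes g: "definable1 g" and d0: "d0 > 0" and mono: "mono_on {0<..<d0} g"
  shows "\<exists>R d. definable1 R \<and> d > 0 \<and>
    (\<forall>x. 0 < x \<and> x < d \<longrightarrow> (g has_real_derivative R x) (at x) \<and> isCont R x)"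
proof -
  note gd = deffun_fun1[OF g]
  define q where "q x h = (g (x + h) - g x) / h" for x h
  define Lim where "Lim x r \<longleftrightarrow> (\<forall>e>0. \<exists>\<delta>>0. \<forall>h. 0 < h \<and> h < \<delta> \<longrightarrow> \<bar>q x h - r\<bar> < e)" for x r
  define T where "T x \<longleftrightarrow> (\<forall>C. \<exists>\<delta>>0. \<forall>h. 0 < h \<and> h < \<delta> \<longrightarrow> C \<le> q x h)" for x
  \<comment> \<open>The value 0 is a default for points without a finite right derivative.\<close>
  define R where "R x = (if \<exists>r. Lim x r then THE r. Lim x r else 0)" for x
  have LimE: "\<exists>\<delta>>0. \<forall>h. 0 < h \<longrightarrow> h < \<delta> \<longrightarrow> \<bar>q x h - r\<bar> < e" if "Lim x r" "e > 0" for x r e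
    using that(1)[unfolded Lim_def, rule_format, OF that(2)] by blast
  have Lim_unique: "r = r'" if rr': "Lim x r" "Lim x r'" for x r r'
  proof (rule ccontr)
    assume "r \<noteq> r'"
    then have e: "\<bar>r - r'\<bar> / 2 > 0" by simp
    obtain a where a: "a > 0" "\<And>h. 0 < h \<Longrightarrow> h < a \<Longrightarrow> \<bar>q x h - r\<bar> < \<bar>r - r'\<bar> / 2"
      using LimE[OF rr'(1) e] by blast
    obtain b where b: "b > 0" "\<And>h. 0 < h \<Longrightarrow> h < b \<Longrightarrow> \<bar>q x h - r'\<bar> < \<bar>r - r'\<bar> / 2"
      using LimE[OF rr'(2) e] by blast
    define h where "h = min a b / 2"
    have h: "0 < h" "h < a" "h < b" using a(1) b(1) by (auto simp: h_def)
    have "\<bar>r - r'\<bar> \<le> \<bar>q x h - r\<bar> + \<bar>q x h - r'\<bar>" by arith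
    also have "\<dots> < \<bar>r - r'\<bar> / 2 + \<bar>r - r'\<bar> / 2"
      using a(2)[OF h(1,2)] b(2)[OF h(1,3)] by (rule add_strict_mono)
    finally show False by simp
  qed
  have R_eq: "R x = r" if "Lim x r" for x r
    using that Lim_unique unfolding R_def by (auto intro: the_equality)
  have LimR: "Lim x (R x)" if "Lim x r" for x r
    using R_eq[OF that] that by simp
  have dR: "definable1 R"
  proof (rule deffun_description[where P = "\<lambda>z r. Lim (last z) r \<or> (\<not> (\<exists>s. Lim (last z) s) \<and> r = 0)"])
    show "defpred (Suc (Suc 0)) (\<lambda>z. Lim (last (butlast z)) (last z) \<or>
        (\<not> (\<exists>s. Lim (last (butlast z)) s) \<and> last z = 0))"
      unfolding Lim_def q_def by (intro definability gd deffun_butlast)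
    show "r = R (last x) \<longleftrightarrow> Lim (last x) r \<or> (\<not> (\<exists>s. Lim (last x) s) \<and> r = 0)" for x r
    proof (cases "\<exists>s. Lim (last x) s")
      case True
      then have "Lim (last x) (R (last x))" using LimR by blast
      then show ?thesis using R_eq[of "last x" r] True by blast
    next
      case False
      then show ?thesis by (auto simp: R_def)
    qed
  qed
  obtain d1 where d1: "d1 > 0" "\<And>x. 0 < x \<Longrightarrow> x < d1 \<Longrightarrow> isCont g x"
    using definable1_germ_continuous[OF g] by blast
  obtain d2 where d2: "d2 > 0" "\<And>x. 0 < x \<Longrightarrow> x < d2 \<Longrightarrow> isCont R x"
    using definable1_germ_continuous[OF dR] by blast
  have dichotomy: "(\<exists>r. Lim x r) \<or> T x" if x: "0 < x" "x < d0" for x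
  proof -
    have "definable1 (q x)" unfolding q_def by (intro definability gd)
    from definable1_germ_mono[OF this] obtain d where d: "d > 0"
      "mono_on {0<..<d} (q x) \<or> mono_on {0<..<d} (\<lambda>h. - q x h)" by blast
    \<comment> \<open>The bound \<open>d0 - x\<close> keeps \<open>x + h\<close> where
      \<open>g\<close> is known to increase, which makes the quotients nonnegative.\<close>
    define c where "c = min d (d0 - x)"
    have c: "c > 0" "c \<le> d" "c \<le> d0 - x" using d x by (auto simp: c_def)
    have q0: "0 \<le> q x h" if "0 < h" "h < c" for h
      using mono that x c unfolding q_def mono_on_def by (intro divide_nonneg_pos) auto
    from d(2) show ?thesis
    proof
      assume "mono_on {0<..<d} (q x)"
      then have "mono_on {0<..<c} (q x)" by (rule mono_on_subset) (use c in auto)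
      from mono_bounded_below_limit[OF c(1) this q0] show ?thesis unfolding Lim_def by blast
    next
      assume m: "mono_on {0<..<d} (\<lambda>h. - q x h)"
      show ?thesis
      proof (cases "\<exists>M. \<forall>h. 0 < h \<and> h < d \<longrightarrow> q x h \<le> M")
        case True
        then obtain M where "\<And>h. 0 < h \<Longrightarrow> h < d \<Longrightarrow> - M \<le> - q x h" by force
        from mono_bounded_below_limit[OF d(1) m this] obtain r where
          r: "\<forall>e>0. \<exists>\<delta>>0. \<forall>h. 0 < h \<and> h < \<delta> \<longrightarrow> \<bar>- q x h - r\<bar> < e" by blast
        have "Lim x (- r)"
          unfolding Lim_def
        proof (intro allI impI)
          fix e :: real assume "e > 0"
          from r[rule_format, OF this] obtain \<delta> where
            "\<delta> > 0" "\<And>h. 0 < h \<and> h < \<delta> \<Longrightarrow> \<bar>- q x h - r\<bar> < e" by blast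
          moreover have "\<bar>q x h - - r\<bar> = \<bar>- q x h - r\<bar>" for h by linarith
          ultimately show "\<exists>\<delta>>0. \<forall>h. 0 < h \<and> h < \<delta> \<longrightarrow> \<bar>q x h - - r\<bar> < e" by auto
        qed
        then show ?thesis by blast
      next
        case False
        have "T x"
          unfolding T_def
        proof
          fix C
          from False obtain h where h: "0 < h" "h < d" "C < q x h" by (auto simp: not_le)
          have "C \<le> q x k" if "0 < k" "k < h" for k
            using mono_onD[OF m, of k h] that h by simp
          then show "\<exists>\<delta>>0. \<forall>h. 0 < h \<and> h < \<delta> \<longrightarrow> C \<le> q x h" using h(1) by blast
        qed
        then show ?thesis ..
      qed
    qed
  qed
  have "defset T" unfolding T_def q_def by (intro definability gd deffun_butlast)
  from defset_germ_0[OF this] have "\<forall>\<^sub>F x in at_right 0. \<not> T x"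
  proof
    assume "\<forall>\<^sub>F x in at_right 0. T x"
    then obtain d where d: "d > 0" "\<And>x. 0 < x \<Longrightarrow> x < d \<Longrightarrow> T x"
      by (auto simp: eventually_at_right_field)
    define b where "b = min d d1 / 2"
    define a where "a = b / 2"
    have ab: "0 < a" "a < b" "b < d" "b < d1" using d(1) d1(1) by (auto simp: a_def b_def)
    \<comment> \<open>One more than the secant slope over \<open>[a, b]\<close>: infinite right
      derivatives on the interval would force the secant slope to be at least
      \<open>C\<close>.\<close>
    define C where "C = (g b - g a) / (b - a) + 1"
    have "C * (b - a) \<le> g b - g a"
    proof (rule le_of_right_slope)
      show "\<exists>\<delta>>0. \<forall>h. 0 < h \<and> h < \<delta> \<longrightarrow> C \<le> (g (x + h) - g x) / h" if "a \<le> x" "x < b" for x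
        using d(2)[of x] that ab unfolding T_def q_def by auto
    qed (use ab d1(2) in auto)
    moreover have "C * (b - a) = g b - g a + (b - a)"
      using ab by (simp add: C_def distrib_right)
    ultimately show ?thesis using ab by simp
  qed
  then obtain d3 where d3: "d3 > 0" "\<And>x. 0 < x \<Longrightarrow> x < d3 \<Longrightarrow> \<not> T x"
    by (auto simp: eventually_at_right_field)
  define d where "d = min (min d0 d1) (min d2 d3)"
  have d: "d > 0" "d \<le> d0" "d \<le> d1" "d \<le> d2" "d \<le> d3"
    using d0 d1(1) d2(1) d3(1) by (auto simp: d_def)
  have Lim: "Lim x (R x)" if "0 < x" "x < d" for x
    using dichotomy[of x] d3(2)[of x] that d LimR by auto
  have "(g has_real_derivative R x) (at x)" if x: "0 < x" "x < d" for x
    unfolding DERIV_def LIM_eq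
  proof (intro allI impI)
    fix r :: real assume "r > 0"
    define e where "e = r / 2"
    have e: "e > 0" using \<open>r > 0\<close> by (simp add: e_def)
    have "isCont R x" using d2(2) x d by auto
    then obtain \<eta>0 where \<eta>0: "\<eta>0 > 0" "\<And>u. \<bar>u - x\<bar> < \<eta>0 \<Longrightarrow> \<bar>R u - R x\<bar> < e"
      unfolding continuous_at_real_range using e by (metis real_norm_def)
    define \<eta> where "\<eta> = min \<eta>0 (min x (d - x))"
    have \<eta>: "\<eta> > 0" "\<eta> \<le> \<eta>0" "\<eta> \<le> x" "\<eta> \<le> d - x" using \<eta>0 x by (auto simp: \<eta>_def)
    \<comment> \<open>Right derivatives near \<open>x\<close> lie within \<open>e\<close> of
      \<open>R x\<close>, hence so do all secant slopes near \<open>x\<close>. Intervals with right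
      end \<open>x\<close> then control the left difference quotients.\<close>
    have slope: "(R x - e) * (b - a) \<le> g b - g a" "(- R x - e) * (b - a) \<le> - g b - - g a"
      if ab: "x - \<eta> < a" "a \<le> b" "b < x + \<eta>" for a b
    proof -
      have near: "\<exists>\<delta>>0. \<forall>h. 0 < h \<and> h < \<delta> \<longrightarrow> R x - e \<le> q u h \<and> q u h \<le> R x + e"
        if "a \<le> u" "u < b" for u
      proof -
        have u: "\<bar>R u - R x\<bar> < e" using \<eta>0(2)[of u] that ab \<eta> by auto
        then have "e - \<bar>R u - R x\<bar> > 0" by simp
        moreover have "Lim u (R u)" using Lim[of u] that ab \<eta> by auto
        ultimately obtain \<delta> where \<delta>: "\<delta> > 0" "\<And>h. 0 < h \<Longrightarrow> h < \<delta> \<Longrightarrow> \<bar>q u h - R u\<bar> < e - \<bar>R u - R x\<bar>"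
          using LimE[of u "R u" "e - \<bar>R u - R x\<bar>"] by blast
        have "R x - e \<le> q u h \<and> q u h \<le> R x + e" if "0 < h" "h < \<delta>" for h
          using \<delta>(2)[OF that] by linarith
        then show ?thesis using \<delta>(1) by blast
      qed
      show "(R x - e) * (b - a) \<le> g b - g a"
      proof (rule le_of_right_slope[OF ab(2)])
        show "\<exists>\<delta>>0. \<forall>h. 0 < h \<and> h < \<delta> \<longrightarrow> R x - e \<le> (g (u + h) - g u) / h"
          if "a \<le> u" "u < b" for u
          using near[OF that] unfolding q_def by blast
      qed (use d1(2) ab \<eta> d in auto)
      show "(- R x - e) * (b - a) \<le> - g b - - g a"
      proof (rule le_of_right_slope[OF ab(2)])
        show "\<exists>\<delta>>0. \<forall>h. 0 < h \<and> h < \<delta> \<longrightarrow> - R x - e \<le> (- g (u + h) - - g u) / h"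
          if u: "a \<le> u" "u < b" for u
        proof -
          obtain \<delta> where \<delta>: "\<delta> > 0" "\<And>h. 0 < h \<and> h < \<delta> \<Longrightarrow> q u h \<le> R x + e"
            using near[OF u] by blast
          have "- R x - e \<le> (- g (u + h) - - g u) / h" if "0 < h \<and> h < \<delta>" for h
          proof -
            have "(- g (u + h) - - g u) / h = - q u h"
              by (simp add: q_def diff_divide_distrib)
            then show ?thesis using \<delta>(2)[OF that] by simp
          qed
          then show ?thesis using \<delta>(1) by blast
        qed
      qed (use d1(2) ab \<eta> d in \<open>auto intro: continuous_minus\<close>)
    qed
    have "\<bar>(g (x + h) - g x) / h - R x\<bar> < r" if h: "h \<noteq> 0" "\<bar>h\<bar> < \<eta>" for h
    proof -
      have "\<bar>(g (x + h) - g x) / h - R x\<bar> \<le> e"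
      proof (cases "h > 0")
        case True
        have "(R x - e) * h \<le> g (x + h) - g x" "(- R x - e) * h \<le> - (g (x + h) - g x)"
          using slope[of x "x + h"] True h by auto
        moreover have "(- R x - e) * h = - ((R x + e) * h)" by (simp add: algebra_simps)
        ultimately have "(R x - e) * h \<le> g (x + h) - g x" "g (x + h) - g x \<le> (R x + e) * h"
          by linarith+
        then have "R x - e \<le> (g (x + h) - g x) / h" "(g (x + h) - g x) / h \<le> R x + e"
          using True by (simp_all only: pos_le_divide_eq pos_divide_le_eq)
        then show ?thesis by linarith
      next
        case False
        then have h0: "h < 0" using h(1) by simp
        have "(R x - e) * - h \<le> g x - g (x + h)" "(- R x - e) * - h \<le> - (g x - g (x + h))"
          using slope[of "x + h" x] h0 h by auto
        moreover have "(- R x - e) * - h = (R x + e) * h" "(R x - e) * - h = - ((R x - e) * h)"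
          by (simp_all add: algebra_simps)
        ultimately have "g (x + h) - g x \<le> (R x - e) * h" "(R x + e) * h \<le> g (x + h) - g x"
          by linarith+
        then have "R x - e \<le> (g (x + h) - g x) / h" "(g (x + h) - g x) / h \<le> R x + e"
          using h0 by (simp_all only: neg_le_divide_eq neg_divide_le_eq)
        then show ?thesis by linarith
      qed
      then show ?thesis using \<open>r > 0\<close> by (simp add: e_def)
    qed
    then show "\<exists>s>0. \<forall>h. h \<noteq> 0 \<and> norm (h - 0) < s \<longrightarrow> norm ((g (x + h) - g x) / h - R x) < r"
      using \<eta>(1) by auto
  qed
  then show ?thesis using dR d d2(2) by (intro exI[of _ R] exI[of _ d]) auto
qed

lemma definable1_germ_C1:
  assumes g: "definable1 g"
  obtains R d where "definable1 R" "d > 0"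
    "\<And>x. 0 < x \<Longrightarrow> x < d \<Longrightarrow> (g has_real_derivative R x) (at x)"
    "\<And>x. 0 < x \<Longrightarrow> x < d \<Longrightarrow> isCont R x"
    "(\<forall>x. 0 < x \<and> x < d \<longrightarrow> 0 \<le> R x) \<or> (\<forall>x. 0 < x \<and> x < d \<longrightarrow> R x \<le> 0)"
proof -
  obtain d0 where d0: "d0 > 0" "mono_on {0<..<d0} g \<or> mono_on {0<..<d0} (\<lambda>x. - g x)"
    using definable1_germ_mono[OF g] by blast
  have "\<exists>R d. definable1 R \<and> d > 0 \<and>
    (\<forall>x. 0 < x \<and> x < d \<longrightarrow> (g has_real_derivative R x) (at x) \<and> isCont R x)"
    using d0(2)
  proof
    assume "mono_on {0<..<d0} (\<lambda>x. - g x)"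
    from definable1_germ_deriv_mono[OF deffun_uminus[OF g] d0(1) this]
    obtain R d where R: "definable1 R" "d > 0"
      "\<And>x. 0 < x \<Longrightarrow> x < d \<Longrightarrow> ((\<lambda>x. - g x) has_real_derivative R x) (at x) \<and> isCont R x" by blast
    have "(g has_real_derivative - R x) (at x) \<and> isCont (\<lambda>x. - R x) x" if "0 < x" "x < d" for x
      using R(3)[OF that] DERIV_minus[of "\<lambda>x. - g x" "R x" x UNIV] by auto
    then show ?thesis
      using R(1,2) by (intro exI[of _ "\<lambda>x. - R x"] exI[of _ d]) (auto intro: deffun_uminus)
  qed (rule definable1_germ_deriv_mono[OF g d0(1)])
  then obtain R d where R: "definable1 R" "d > 0"
    "\<And>x. 0 < x \<Longrightarrow> x < d \<Longrightarrow> (g has_real_derivative R x) (at x) \<and> isCont R x" by blast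
  have "defset (\<lambda>x. 0 \<le> R x)" by (intro definability deffun_fun1[OF R(1)])
  from defset_germ_0[OF this]
  have "\<exists>d'>0. (\<forall>x. 0 < x \<and> x < d' \<longrightarrow> 0 \<le> R x) \<or> (\<forall>x. 0 < x \<and> x < d' \<longrightarrow> R x \<le> 0)"
    by (force simp: eventually_at_right_field not_le)
  then obtain d' where d': "d' > 0"
    "(\<forall>x. 0 < x \<and> x < d' \<longrightarrow> 0 \<le> R x) \<or> (\<forall>x. 0 < x \<and> x < d' \<longrightarrow> R x \<le> 0)" by blast
  show thesis
    by (rule that[of R "min d d'"]) (use R d' in auto)
qed

section \<open>Definable maps with values in R^n\<close>

definition deflist :: "nat \<Rightarrow> nat \<Rightarrow> (real list \<Rightarrow> real list) \<Rightarrow> bool" where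
  "deflist k n L \<longleftrightarrow> (\<forall>z\<in>rspace k. L z \<in> rspace n) \<and> (\<forall>i<n. deffun k (\<lambda>z. L z ! i))"

lemma defpred_deflist:
  assumes P: "defpred n P" and L: "deflist k n L"
  shows "defpred k (\<lambda>z. P (L z))"
proof -
  let ?Fs = "map (\<lambda>i z. L z ! i) [0..<n]"
  have "defpred k (\<lambda>z. P (map (\<lambda>F. F z) ?Fs))"
    using P L by (intro defpred_subst) (auto simp: deflist_def)
  also have "?this \<longleftrightarrow> ?thesis"
  proof (rule defpred_cong)
    fix z assume "z \<in> rspace k"
    then have "length (L z) = n" using L by (simp add: deflist_def rspace_def)
    then have "map (\<lambda>F. F z) ?Fs = L z" by (intro nth_equalityI) auto
    then show "P (map (\<lambda>F. F z) ?Fs) = P (L z)" by simp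
  qed
  finally show ?thesis .
qed

lemma deflist_id: "deflist n n (\<lambda>z. z)"
  by (auto simp: deflist_def intro: deffun_nth)

lemma deflist_butlast: "deflist k n L \<Longrightarrow> deflist (Suc k) n (\<lambda>z. L (butlast z))"
  by (auto simp: deflist_def rspace_Suc intro: deffun_butlast[of _ "\<lambda>z. L z ! _"])

lemma deflist_Nil: "deflist k 0 (\<lambda>z. [])"
  by (simp add: deflist_def rspace_def)

lemma deflist_append:
  assumes L: "deflist k m L" and M: "deflist k n M"
  shows "deflist k (m + n) (\<lambda>z. L z @ M z)"
  unfolding deflist_def
proof (intro conjI allI impI ballI)
  fix i assume i: "i < m + n"
  have "deffun k (\<lambda>z. if i < m then L z ! i else M z ! (i - m))"
    using L M i by (cases "i < m") (auto simp: deflist_def)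
  also have "?this \<longleftrightarrow> deffun k (\<lambda>z. (L z @ M z) ! i)"
    using L by (intro deffun_cong) (auto simp: deflist_def rspace_def nth_append)
  finally show "deffun k (\<lambda>z. (L z @ M z) ! i)" .
qed (use L M in \<open>auto simp: deflist_def rspace_def\<close>)

lemma deflist_snoc: "deflist k n L \<Longrightarrow> deffun k F \<Longrightarrow> deflist k (Suc n) (\<lambda>z. L z @ [F z])"
  using deflist_append[of k n L 1 "\<lambda>z. [F z]"] by (simp add: deflist_def rspace_def)

lemma deffun_deflist:
  assumes G: "deffun n G" and L: "deflist k n L"
  shows "deffun k (\<lambda>z. G (L z))"
  using defpred_deflist[OF G[unfolded deffun_def] deflist_snoc[OF deflist_butlast[OF L] deffun_last]]
  by (simp add: deffun_def)

section \<open>Definable choice\<close>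

lemma deflist_const: "c \<in> rspace n \<Longrightarrow> deflist k n (\<lambda>z. c)"
  by (simp add: deflist_def deffun_const)

lemma deflist_take: "deflist k m L \<Longrightarrow> a \<le> m \<Longrightarrow> deflist k a (\<lambda>z. take a (L z))"
  by (simp add: deflist_def rspace_def)

lemma deflist_drop:
  assumes "deflist k (a + b) L"
  shows "deflist k b (\<lambda>z. drop a (L z))"
  unfolding deflist_def
proof (intro conjI allI impI ballI)
  fix i assume "i < b"
  then have "deffun k (\<lambda>z. L z ! (a + i))" using assms by (simp add: deflist_def)
  also have "?this \<longleftrightarrow> deffun k (\<lambda>z. drop a (L z) ! i)"
    using assms by (intro deffun_cong) (auto simp: deflist_def rspace_def)
  finally show "deffun k (\<lambda>z. drop a (L z) ! i)" .
qed (use assms in \<open>auto simp: deflist_def rspace_def\<close>)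

lemma defpred_apply:
  assumes "defpred (Suc n) (\<lambda>z. P (butlast z) (last z))" "deflist k n L" "deffun k F"
  shows "defpred k (\<lambda>z. P (L z) (F z))"
  using defpred_deflist[OF assms(1) deflist_snoc[OF assms(2,3)]] by simp

text \<open>Being the least upper bound is a first-order condition; boundedness makes it agree with
  \<open>Sup\<close>, and an empty fibre receives the default 0.\<close>

lemma deffun_Sup:
  assumes P: "defpred (Suc n) (\<lambda>z. P (butlast z) (last z))"
    and bdd: "\<And>x. x \<in> rspace n \<Longrightarrow> bdd_above {t. P x t}"
  shows "deffun n (\<lambda>x. if \<exists>t. P x t then Sup {t. P x t} else 0)"
proof (rule deffun_description[where P = "\<lambda>x r. ((\<exists>t. P x t) \<and> (\<forall>t. P x t \<longrightarrow> t \<le> r) \<and>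
    (\<forall>b. (\<forall>t. P x t \<longrightarrow> t \<le> b) \<longrightarrow> r \<le> b)) \<or> (\<not> (\<exists>t. P x t) \<and> r = 0)"])
  show "defpred (Suc n) (\<lambda>z. ((\<exists>t. P (butlast z) t) \<and> (\<forall>t. P (butlast z) t \<longrightarrow> t \<le> last z) \<and>
    (\<forall>b. (\<forall>t. P (butlast z) t \<longrightarrow> t \<le> b) \<longrightarrow> last z \<le> b)) \<or> (\<not> (\<exists>t. P (butlast z) t) \<and> last z = 0))"
    by (intro definability defpred_apply[OF P] deflist_butlast deflist_id deffun_butlast)
  fix x r assume x: "x \<in> rspace n"
  show "(r = (if \<exists>t. P x t then Sup {t. P x t} else 0)) \<longleftrightarrow> ((\<exists>t. P x t) \<and> (\<forall>t. P x t \<longrightarrow> t \<le> r) \<and>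
    (\<forall>b. (\<forall>t. P x t \<longrightarrow> t \<le> b) \<longrightarrow> r \<le> b)) \<or> (\<not> (\<exists>t. P x t) \<and> r = 0)"
  proof (cases "\<exists>t. P x t")
    case True
    then have ne: "{t. P x t} \<noteq> {}" by blast
    have up: "t \<le> Sup {t. P x t}" if "P x t" for t
      using that bdd[OF x] by (intro cSup_upper) auto
    have least: "Sup {t. P x t} \<le> b" if "\<forall>t. P x t \<longrightarrow> t \<le> b" for b
      using that ne by (intro cSup_least) auto
    show ?thesis
    proof
      assume "(\<exists>t. P x t) \<and> (\<forall>t. P x t \<longrightarrow> t \<le> r) \<and> (\<forall>b. (\<forall>t. P x t \<longrightarrow> t \<le> b) \<longrightarrow> r \<le> b) \<or>
        \<not> (\<exists>t. P x t) \<and> r = 0"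
      then have r: "\<forall>t. P x t \<longrightarrow> t \<le> r" "\<And>b. (\<forall>t. P x t \<longrightarrow> t \<le> b) \<Longrightarrow> r \<le> b"
        using True by simp_all
      have "r \<le> Sup {t. P x t}" using up by (intro r(2)) simp
      then have "r = Sup {t. P x t}" using least[OF r(1)] by simp
      then show "r = (if \<exists>t. P x t then Sup {t. P x t} else 0)" using True by simp
    qed (use True up least in auto)
  qed simp
qed

text \<open>The point chosen in a fibre is, up to sign, the largest \<open>- \<bar>t\<bar>\<close> if this is attained;
  otherwise, by o-minimality, an interval ends at the supremum of these values.\<close>

lemma definable_choice1:
  assumes P: "defpred (Suc n) (\<lambda>z. P (butlast z) (last z))"
  shows "\<exists>F. deffun n F \<and> (\<forall>x\<in>rspace n. (\<exists>t. P x t) \<longrightarrow> P x (F x))"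
proof -
  \<comment> \<open>Folding the fibre onto the nonpositive half-line bounds it above, so that its
    supremum exists.\<close>
  define A where "A x e \<longleftrightarrow> e \<le> 0 \<and> (P x e \<or> P x (- e))" for x e
  define s where "s x = (if \<exists>t. A x t then Sup {t. A x t} else 0)" for x
  \<comment> \<open>Lengths of intervals of the folded fibre that end at \<open>s x\<close>; the cap
    1 keeps their supremum \<open>\<mu> x\<close> finite. Some such length exceeds
    \<open>\<mu> x / 2\<close>, so the point \<open>s x - \<mu> x / 2\<close> lies in one of these
    intervals.\<close>
  define M where "M x m \<longleftrightarrow> 0 < m \<and> m \<le> 1 \<and> (\<forall>y. s x - m < y \<longrightarrow> y < s x \<longrightarrow> A x y)" for x m
  define \<mu> where "\<mu> x = (if \<exists>t. M x t then Sup {t. M x t} else 0)" for x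
  define e where "e x = (if A x (s x) then s x else s x - \<mu> x / 2)" for x
  define F where "F x = (if P x (e x) then e x else - e x)" for x
  note PA = defpred_apply[OF P]
  have dA: "defpred (Suc n) (\<lambda>z. A (butlast z) (last z))"
    unfolding A_def by (intro definability PA deflist_butlast deflist_id)
  note AA = defpred_apply[OF dA]
  have bA: "bdd_above {t. A x t}" for x by (auto simp: A_def bdd_above_def)
  have ds: "deffun n s"
    unfolding s_def by (rule deffun_Sup[OF dA bA])
  have dM: "defpred (Suc n) (\<lambda>z. M (butlast z) (last z))"
    unfolding M_def
    by (intro definability AA deflist_butlast deflist_id deffun_butlast ds)
  have bM: "bdd_above {t. M x t}" for x by (auto simp: M_def bdd_above_def)
  have d\<mu>: "deffun n \<mu>"
    unfolding \<mu>_def by (rule deffun_Sup[OF dM bM])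
  have de: "deffun n e"
    unfolding e_def by (intro deffun_if definability AA deflist_id ds d\<mu>)
  have "deffun n F"
    unfolding F_def by (intro deffun_if definability PA deflist_id de)
  moreover have "P x (F x)" if x: "x \<in> rspace n" and t: "\<exists>t. P x t" for x
  proof -
    obtain t where t: "P x t" using t by blast
    have "A x (- \<bar>t\<bar>)" using t by (auto simp: A_def abs_if)
    then have exA: "\<exists>t. A x t" by blast
    then have ne: "{t. A x t} \<noteq> {}" and s: "s x = Sup {t. A x t}" by (auto simp: s_def)
    have "A x (e x)"
    proof (cases "A x (s x)")
      case False
      have near: "\<exists>t. A x t \<and> b < t \<and> t < s x" if b: "b < s x" for b
      proof -
        obtain t where t: "A x t" "b < t"
          using less_cSupD[OF ne b[unfolded s]] by auto
        have "t \<le> s x" unfolding s using t(1) bA by (intro cSup_upper) auto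
        moreover have "t \<noteq> s x" using t(1) False by blast
        ultimately show ?thesis using t by auto
      qed
      \<comment> \<open>As \<open>s x\<close> is not attained, the folded fibre accumulates at it
        from the left, and the germ dichotomy turns this accumulation into an interval.\<close>
      have "defset (A x)"
        by (intro AA deflist_const x deffun_last)
      from defset_germ_left[OF this, of "s x"] obtain b where b: "b < s x" "\<And>y. b < y \<Longrightarrow> y < s x \<Longrightarrow> A x y"
        using near by (force simp: eventually_at_left_field)
      have "M x (min 1 (s x - b))" using b by (auto simp: M_def)
      then have M: "\<exists>t. M x t" by blast
      then have neM: "{t. M x t} \<noteq> {}" and \<mu>: "\<mu> x = Sup {t. M x t}" by (auto simp: \<mu>_def)
      obtain m where "M x m" using M by blast
      moreover have "m \<le> \<mu> x" unfolding \<mu> using \<open>M x m\<close> bM by (intro cSup_upper) auto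
      ultimately have "\<mu> x > 0" by (auto simp: M_def)
      then have "\<mu> x / 2 < Sup {t. M x t}" unfolding \<mu>[symmetric] by simp
      from less_cSupD[OF neM this] obtain m' where "M x m'" "\<mu> x / 2 < m'" by auto
      then have "A x (s x - \<mu> x / 2)" using \<open>\<mu> x > 0\<close> by (simp add: M_def)
      then show ?thesis using False by (simp add: e_def)
    qed (simp add: e_def)
    then show ?thesis by (auto simp: F_def A_def)
  qed
  ultimately show ?thesis by blast
qed

text \<open>Induction on the number of chosen coordinates: all but the last are chosen so that a
  last one exists, which is then chosen as a definable function of \<open>x\<close> and of the
  others.\<close>

lemma definable_choice:
  assumes "defpred (n + k) Q"
  shows "\<exists>L. deflist n k L \<and> (\<forall>x\<in>rspace n. (\<exists>y\<in>rspace k. Q (x @ y)) \<longrightarrow> Q (x @ L x))"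
  using assms
proof (induction k arbitrary: Q)
  case 0
  show ?case by (rule exI[of _ "\<lambda>x. []"]) (auto simp: deflist_Nil rspace_def)
next
  case (Suc k)
  have "defpred (Suc (n + k)) (\<lambda>z. Q (butlast z @ [last z])) \<longleftrightarrow> defpred (Suc (n + k)) Q"
    by (rule defpred_Suc_cong) simp
  then have Q: "defpred (Suc (n + k)) (\<lambda>z. Q (butlast z @ [last z]))" using Suc.prems by simp
  from definable_choice1[OF this] obtain G where G: "deffun (n + k) G"
    "\<And>w. w \<in> rspace (n + k) \<Longrightarrow> (\<exists>t. Q (w @ [t])) \<Longrightarrow> Q (w @ [G w])" by blast
  from Suc.IH[OF defpred_ex[OF Q]] obtain L where L: "deflist n k L"
    "\<And>x. x \<in> rspace n \<Longrightarrow> \<exists>y\<in>rspace k. \<exists>t. Q ((x @ y) @ [t]) \<Longrightarrow> \<exists>t. Q ((x @ L x) @ [t])" by blast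
  have "deflist n (Suc k) (\<lambda>x. L x @ [G (x @ L x)])"
    by (intro deflist_snoc L(1) deffun_deflist[OF G(1)] deflist_append deflist_id)
  moreover have "Q (x @ L x @ [G (x @ L x)])" if x: "x \<in> rspace n" "\<exists>y\<in>rspace (Suc k). Q (x @ y)" for x
  proof -
    obtain y t where "y \<in> rspace k" "Q (x @ y @ [t])"
      using x(2) by (auto simp: rspace_Suc)
    then have "\<exists>y\<in>rspace k. \<exists>t. Q ((x @ y) @ [t])" by (auto intro!: bexI[of _ y] exI[of _ t])
    from L(2)[OF x(1) this] have "\<exists>t. Q ((x @ L x) @ [t])" .
    moreover have "x @ L x \<in> rspace (n + k)" using x(1) L(1) by (auto simp: deflist_def rspace_def)
    ultimately show ?thesis using G(2)[of "x @ L x"] by simp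
  qed
  ultimately show ?case by (intro exI[of _ "\<lambda>x. L x @ [G (x @ L x)]"]) blast
qed

end

section \<open>Conservative fields along curves\<close>

lemma lipschitz_abs_cont_on01:
  fixes \<gamma> :: "real \<Rightarrow> 'a::real_normed_vector"
  assumes lip: "\<And>s t. 0 \<le> s \<Longrightarrow> s \<le> t \<Longrightarrow> t \<le> 1 \<Longrightarrow> norm (\<gamma> t - \<gamma> s) \<le> C * (t - s)"
  shows "abs_cont_on01 \<gamma>"
  unfolding abs_cont_on01_def
proof (intro allI impI)
  fix \<epsilon> :: real assume "\<epsilon> > 0"
  define K where "K = \<bar>C\<bar> + 1"
  have K: "K > 0" "C \<le> K" by (auto simp: K_def)
  show "\<exists>\<delta>>0. \<forall>(n::nat) a b. (\<forall>i<n. 0 \<le> a i \<and> a i \<le> b i \<and> b i \<le> 1) \<and>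
      (\<forall>i<n. \<forall>j<n. i \<noteq> j \<longrightarrow> b i \<le> a j \<or> b j \<le> a i) \<and> (\<Sum>i<n. b i - a i) < \<delta> \<longrightarrow>
      (\<Sum>i<n. norm (\<gamma> (b i) - \<gamma> (a i))) < \<epsilon>"
  proof (intro exI[of _ "\<epsilon> / K"] conjI allI impI)
    show "\<epsilon> / K > 0" using \<open>\<epsilon> > 0\<close> K by simp
    fix n :: nat and a b :: "nat \<Rightarrow> real"
    assume ab: "(\<forall>i<n. 0 \<le> a i \<and> a i \<le> b i \<and> b i \<le> 1) \<and>
      (\<forall>i<n. \<forall>j<n. i \<noteq> j \<longrightarrow> b i \<le> a j \<or> b j \<le> a i) \<and> (\<Sum>i<n. b i - a i) < \<epsilon> / K"
    have "(\<Sum>i<n. norm (\<gamma> (b i) - \<gamma> (a i))) \<le> (\<Sum>i<n. K * (b i - a i))"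
    proof (rule sum_mono)
      fix i assume "i \<in> {..<n}"
      then have i: "0 \<le> a i" "a i \<le> b i" "b i \<le> 1" using ab by auto
      have "C * (b i - a i) \<le> K * (b i - a i)" using i K(2) by (intro mult_right_mono) auto
      then show "norm (\<gamma> (b i) - \<gamma> (a i)) \<le> K * (b i - a i)" using lip[OF i] by simp
    qed
    also have "\<dots> = K * (\<Sum>i<n. b i - a i)" by (simp add: sum_distrib_left)
    also have "\<dots> < \<epsilon>" using ab K(1) by (simp add: pos_less_divide_eq mult.commute)
    finally show "(\<Sum>i<n. norm (\<gamma> (b i) - \<gamma> (a i))) < \<epsilon>" .
  qed
qed

lemma field_integrand_eq:
  assumes "(\<gamma> has_vector_derivative \<gamma>') (at t)" and "0 < t" "t < 1"
  shows "field_integrand D \<gamma> t = (SUP v\<in>D (\<gamma> t). inner \<gamma>' v)"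
proof -
  have "at t within {0..1} = at t"
    using assms(2,3) by (intro at_within_interior) (simp add: interior_atLeastAtMost_real)
  then have "vector_derivative \<gamma> (at t within {0..1}) = \<gamma>'"
    using vector_derivative_at[OF assms(1)] by simp
  then show ?thesis by (simp add: field_integrand_def)
qed

text \<open>To compare \<open>f\<close> at the two ends of \<open>\<gamma>\<close>, run from \<open>0\<close> straight to \<open>\<gamma> a\<close>, and then either
  stay there or follow \<open>\<gamma>\<close>; the two integrands agree on the first half of the time.\<close>

lemma conservative_field_decrease:
  fixes f :: "real ^ 'n \<Rightarrow> real" and \<gamma> :: "real \<Rightarrow> real ^ 'n"
  assumes cons: "conservative_field_for D f" and "a < b"
    and deriv: "\<And>t. a \<le> t \<Longrightarrow> t \<le> b \<Longrightarrow> (\<gamma> has_vector_derivative \<gamma>' t) (at t)"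
    and cont: "continuous_on {a..b} \<gamma>'"
    and v: "\<And>t. a \<le> t \<Longrightarrow> t \<le> b \<Longrightarrow> v t \<in> D (\<gamma> t) \<and> norm (\<gamma>' t) * norm (v t) \<le> c"
  shows "- c * (b - a) \<le> f (\<gamma> b) - f (\<gamma> a)"
proof -
  define x0 where "x0 = \<gamma> a"
  \<comment> \<open>\<open>p\<close> waits at \<open>a\<close> until time 1/2 and then crosses
    \<open>[a, b]\<close> with speed \<open>2 * (b - a)\<close>. One formula for
    \<open>\<Gamma>\<close> thus covers both halves, and its Lipschitz constant is a sum of
    two.\<close>
  define p where "p \<tau> = a + (2 * max \<tau> (1/2) - 1) * (b - a)" for \<tau> :: real
  define \<Gamma>2 where "\<Gamma>2 \<tau> = (2 * min \<tau> (1/2)) *\<^sub>R x0" for \<tau> :: real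
  define \<Gamma> where "\<Gamma> \<tau> = \<Gamma>2 \<tau> + (\<gamma> (p \<tau>) - x0)" for \<tau>
  have "bounded (\<gamma>' ` {a..b})"
    using cont by (intro compact_imp_bounded compact_continuous_image) auto
  then obtain B where B: "\<And>t. a \<le> t \<Longrightarrow> t \<le> b \<Longrightarrow> norm (\<gamma>' t) \<le> B"
    unfolding bounded_iff by force
  then have "B \<ge> 0" using \<open>a < b\<close> by (meson norm_ge_zero order_refl order_trans less_imp_le)
  have \<gamma>_lip: "norm (\<gamma> y - \<gamma> x) \<le> B * \<bar>y - x\<bar>" if "x \<in> {a..b}" "y \<in> {a..b}" for x y
  proof -
    have "norm (\<gamma> y - \<gamma> x) \<le> B * norm (y - x)"
    proof (rule differentiable_bound)
      show "(\<gamma> has_derivative (\<lambda>h. h *\<^sub>R \<gamma>' t)) (at t within {a..b})" if "t \<in> {a..b}" for t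
        using deriv[of t] that has_derivative_at_withinI by (auto simp: has_vector_derivative_def)
      show "onorm (\<lambda>h. h *\<^sub>R \<gamma>' t) \<le> B" if "t \<in> {a..b}" for t
        using mult_left_mono[OF B[of t] abs_ge_zero] that
        by (intro onorm_le) (auto simp: mult.commute[of B])
    qed (use that in auto)
    then show ?thesis by simp
  qed
  have p_mem: "p \<tau> \<in> {a..b}" if "\<tau> \<le> 1" for \<tau>
  proof -
    define r where "r = 2 * max \<tau> (1/2) - 1"
    have "0 \<le> r" "r \<le> 1" using that by (auto simp: r_def)
    then have "0 \<le> r * (b - a)" "r * (b - a) \<le> 1 * (b - a)"
      using \<open>a < b\<close> by (auto intro: mult_right_mono)
    then show ?thesis by (simp add: p_def r_def[symmetric])
  qed
  have lip2: "norm (\<Gamma>2 t - \<Gamma>2 s) \<le> (2 * norm x0) * (t - s)" if "s \<le> t" for s t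
  proof -
    have m: "0 \<le> 2 * min t (1/2) - 2 * min s (1/2)"
      "2 * min t (1/2) - 2 * min s (1/2) \<le> 2 * (t - s)"
      using that by (auto simp: min_def)
    have "norm (\<Gamma>2 t - \<Gamma>2 s) = (2 * min t (1/2) - 2 * min s (1/2)) * norm x0"
      unfolding \<Gamma>2_def scaleR_left_diff_distrib[symmetric] norm_scaleR using m(1) by simp
    also have "\<dots> \<le> 2 * (t - s) * norm x0" using m(2) by (intro mult_right_mono) auto
    also have "\<dots> = (2 * norm x0) * (t - s)" by simp
    finally show ?thesis .
  qed
  have lip: "norm (\<Gamma> t - \<Gamma> s) \<le> (2 * norm x0 + B * (2 * (b - a))) * (t - s)"
    if "0 \<le> s" "s \<le> t" "t \<le> 1" for s t
  proof -
    have "norm (\<gamma> (p t) - \<gamma> (p s)) \<le> B * \<bar>p t - p s\<bar>"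
      using that by (intro \<gamma>_lip p_mem) auto
    also have "p t - p s = 2 * (b - a) * (max t (1/2) - max s (1/2))"
      by (simp add: p_def algebra_simps)
    also have "B * \<bar>2 * (b - a) * (max t (1/2) - max s (1/2))\<bar> \<le> B * (2 * (b - a) * (t - s))"
    proof (rule mult_left_mono[OF _ \<open>B \<ge> 0\<close>])
      have "\<bar>max t (1/2) - max s (1/2)\<bar> \<le> t - s" using that by (auto simp: max_def)
      then have "2 * (b - a) * \<bar>max t (1/2) - max s (1/2)\<bar> \<le> 2 * (b - a) * (t - s)"
        using \<open>a < b\<close> by (intro mult_left_mono) auto
      then show "\<bar>2 * (b - a) * (max t (1/2) - max s (1/2))\<bar> \<le> 2 * (b - a) * (t - s)"
        using \<open>a < b\<close> by (simp add: abs_mult)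
    qed
    finally have "norm (\<gamma> (p t) - \<gamma> (p s)) \<le> B * (2 * (b - a)) * (t - s)" by (simp add: mult.assoc)
    moreover have "norm (\<Gamma> t - \<Gamma> s) \<le> norm (\<Gamma>2 t - \<Gamma>2 s) + norm (\<gamma> (p t) - \<gamma> (p s))"
      unfolding \<Gamma>_def by (rule order_trans[OF _ norm_triangle_ineq]) (simp add: algebra_simps)
    ultimately show ?thesis using lip2[OF that(2)] by (simp add: distrib_right)
  qed
  have ends: "\<Gamma> 0 = 0" "\<Gamma> 1 = \<gamma> b" "\<Gamma>2 0 = 0" "\<Gamma>2 1 = x0"
    by (simp_all add: \<Gamma>_def \<Gamma>2_def p_def x0_def)
  have I1: "(field_integrand D \<Gamma> has_integral f (\<gamma> b) - f 0) {0..1}"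
    using cons lipschitz_abs_cont_on01[OF lip] ends unfolding conservative_field_for_def by metis
  have I2: "(field_integrand D \<Gamma>2 has_integral f x0 - f 0) {0..1}"
    using cons lipschitz_abs_cont_on01[OF lip2] ends unfolding conservative_field_for_def by metis
  have diff: "((\<lambda>\<tau>. field_integrand D \<Gamma> \<tau> - field_integrand D \<Gamma>2 \<tau>)
      has_integral f (\<gamma> b) - f (\<gamma> a)) {0..1}"
    using has_integral_diff[OF I1 I2] by (simp add: x0_def)
  have ne: "D x \<noteq> {}" and cpt: "compact (D x)" for x
    using cons by (auto simp: conservative_field_for_def conservative_field_def)
  \<comment> \<open>A minorant for the difference of the two integrands: 0 while the curves agree,
    then \<open>- c\<close> times the speed of \<open>p\<close>. Its integral is
    \<open>- c * (b - a)\<close>.\<close>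
  define l where "l \<tau> = (if \<tau> \<in> {1/2..1} then - (2 * c * (b - a)) else 0)" for \<tau> :: real
  have "((\<lambda>\<tau>::real. - (2 * c * (b - a))) has_integral (1 - 1/2) *\<^sub>R - (2 * c * (b - a))) {1/2..1}"
    using has_integral_const_real[of "- (2 * c * (b - a))" "1/2" 1] by simp
  then have l: "(l has_integral - c * (b - a)) {0..1}"
    unfolding l_def by (subst has_integral_restrict) (auto simp: algebra_simps)
  \<comment> \<open>At the corner 1/2 and at the two end points the derivative formulas are not
    applied; altering the integrand at finitely many points leaves the integral unchanged.\<close>
  define E where "E = {0, 1/2, 1 :: real}"
  have "finite E" by (simp add: E_def)
  define h where "h \<tau> = (if \<tau> \<in> E then l \<tau> else field_integrand D \<Gamma> \<tau> - field_integrand D \<Gamma>2 \<tau>)" for \<tau>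
  have h: "(h has_integral f (\<gamma> b) - f (\<gamma> a)) {0..1}"
    by (rule has_integral_spike_finite[OF \<open>finite E\<close> _ diff]) (simp add: h_def)
  have "l \<tau> \<le> h \<tau>" if \<tau>: "\<tau> \<in> {0..1}" for \<tau>
  proof (cases "\<tau> \<in> E")
    case False
    then consider "0 < \<tau>" "\<tau> < 1/2" | "1/2 < \<tau>" "\<tau> < 1" using \<tau> by (force simp: E_def)
    then show ?thesis
    proof cases
      case 1
      have d: "((\<lambda>\<tau>. (2 * \<tau>) *\<^sub>R x0) has_vector_derivative 2 *\<^sub>R x0) (at \<tau>)"
        by (auto intro!: derivative_eq_intros)
      have d2: "(\<Gamma>2 has_vector_derivative 2 *\<^sub>R x0) (at \<tau>)"
        by (rule has_vector_derivative_transform_within_open[OF d, of "{0<..<1/2}"])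
          (use 1 in \<open>auto simp: \<Gamma>2_def\<close>)
      have d1: "(\<Gamma> has_vector_derivative 2 *\<^sub>R x0) (at \<tau>)"
        by (rule has_vector_derivative_transform_within_open[OF d, of "{0<..<1/2}"])
          (use 1 in \<open>auto simp: \<Gamma>_def \<Gamma>2_def p_def x0_def\<close>)
      have "\<Gamma> \<tau> = \<Gamma>2 \<tau>" using 1 by (simp add: \<Gamma>_def p_def x0_def)
      then have "field_integrand D \<Gamma> \<tau> = field_integrand D \<Gamma>2 \<tau>"
        using field_integrand_eq[OF d1] field_integrand_eq[OF d2] 1 by simp
      then show ?thesis using 1 False by (simp add: h_def l_def)
    next
      case 2
      have d: "((\<lambda>\<tau>. x0) has_vector_derivative 0) (at \<tau>)" by simp
      have d2: "(\<Gamma>2 has_vector_derivative 0) (at \<tau>)"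
        by (rule has_vector_derivative_transform_within_open[OF d, of "{1/2<..<1}"])
          (use 2 in \<open>auto simp: \<Gamma>2_def\<close>)
      have "field_integrand D \<Gamma>2 \<tau> = 0"
        using field_integrand_eq[OF d2] 2 ne by simp
      define u where "u = a + (2 * \<tau> - 1) * (b - a)"
      have u: "p \<tau> = u" "u \<in> {a..b}" using p_mem[of \<tau>] 2 by (auto simp: p_def u_def)
      have "((\<lambda>\<tau>. a + (2 * \<tau> - 1) * (b - a)) has_vector_derivative 2 * (b - a)) (at \<tau>)"
        unfolding has_real_derivative_iff_has_vector_derivative[symmetric]
        by (auto intro!: derivative_eq_intros)
      moreover have "(\<gamma> has_vector_derivative \<gamma>' u) (at (a + (2 * \<tau> - 1) * (b - a)))"
        using deriv[of u] u by (simp add: u_def)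
      ultimately have d: "(\<gamma> \<circ> (\<lambda>\<tau>. a + (2 * \<tau> - 1) * (b - a)) has_vector_derivative
          (2 * (b - a)) *\<^sub>R \<gamma>' u) (at \<tau>)"
        by (rule vector_diff_chain_at)
      have d1: "(\<Gamma> has_vector_derivative (2 * (b - a)) *\<^sub>R \<gamma>' u) (at \<tau>)"
        by (rule has_vector_derivative_transform_within_open[OF d, of "{1/2<..<1}"])
          (use 2 in \<open>auto simp: \<Gamma>_def \<Gamma>2_def p_def\<close>)
      have "\<Gamma> \<tau> = \<gamma> u" using 2 u by (simp add: \<Gamma>_def \<Gamma>2_def)
      then have FI: "field_integrand D \<Gamma> \<tau> = (SUP v\<in>D (\<gamma> u). inner ((2 * (b - a)) *\<^sub>R \<gamma>' u) v)"
        using field_integrand_eq[OF d1] 2 by simp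
      have "compact ((\<lambda>v. inner ((2 * (b - a)) *\<^sub>R \<gamma>' u) v) ` D (\<gamma> u))"
        by (intro compact_continuous_image cpt continuous_intros)
      then have bdd: "bdd_above ((\<lambda>v. inner ((2 * (b - a)) *\<^sub>R \<gamma>' u) v) ` D (\<gamma> u))"
        by (intro bounded_imp_bdd_above compact_imp_bounded)
      \<comment> \<open>The supremum over \<open>D (\<gamma> u)\<close> is bounded below by its
        value at the single element \<open>v u\<close>, so the selection \<open>v\<close> may be
        arbitrarily irregular in time.\<close>
      have vu: "v u \<in> D (\<gamma> u)" "norm (\<gamma>' u) * norm (v u) \<le> c" using v[of u] u by auto
      have "- inner (\<gamma>' u) (v u) \<le> c"
        using Cauchy_Schwarz_ineq2[of "\<gamma>' u" "v u"] vu(2) by linarith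
      then have "2 * (b - a) * - inner (\<gamma>' u) (v u) \<le> 2 * (b - a) * c"
        using \<open>a < b\<close> by (intro mult_left_mono) auto
      then have "- (2 * c * (b - a)) \<le> inner ((2 * (b - a)) *\<^sub>R \<gamma>' u) (v u)"
        by (simp add: algebra_simps)
      also have "\<dots> \<le> field_integrand D \<Gamma> \<tau>"
        unfolding FI by (rule cSUP_upper[OF vu(1) bdd])
      finally show ?thesis
        using False 2 \<open>field_integrand D \<Gamma>2 \<tau> = 0\<close> by (simp add: h_def l_def)
    qed
  qed (simp add: h_def)
  then show ?thesis by (rule has_integral_le[OF l h])
qed

section \<open>Passage between vectors and lists of coordinates\<close>

definition enum_index :: "'n::enum \<Rightarrow> nat" where
  "enum_index = inv_into {..<CARD('n)} (\<lambda>k. (Enum.enum :: 'n list) ! k)"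

definition list_vec :: "real list \<Rightarrow> real ^ 'n::enum" where
  "list_vec xs = (\<chi> i. xs ! enum_index i)"

lemma length_enum: "length (Enum.enum :: 'n::enum list) = CARD('n)"
  by (simp add: card_UNIV_length_enum)

lemma bij_betw_enum_nth: "bij_betw (\<lambda>k. (Enum.enum :: 'n::enum list) ! k) {..<CARD('n)} UNIV"
  by (rule bij_betw_nth) (auto simp: enum_distinct enum_UNIV length_enum)

lemma enum_index_less: "enum_index (i :: 'n::enum) < CARD('n)"
  using bij_betw_apply[OF bij_betw_inv_into[OF bij_betw_enum_nth], of i]
  by (simp add: enum_index_def)

lemma enum_nth_index: "(Enum.enum :: 'n::enum list) ! enum_index (i :: 'n) = i"
  unfolding enum_index_def by (rule bij_betw_inv_into_right[OF bij_betw_enum_nth]) simp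

lemma enum_index_nth: "k < CARD('n::enum) \<Longrightarrow> enum_index ((Enum.enum :: 'n list) ! k) = k"
  unfolding enum_index_def by (rule bij_betw_inv_into_left[OF bij_betw_enum_nth]) simp

lemma length_vec_list: "length (vec_list (x :: real ^ 'n::enum)) = CARD('n)"
  by (simp add: vec_list_def length_enum)

lemma list_vec_vec_list: "list_vec (vec_list x) = (x :: real ^ 'n::enum)"
  by (simp add: vec_eq_iff list_vec_def vec_list_def length_enum enum_index_less enum_nth_index)

lemma vec_list_list_vec: "xs \<in> rspace CARD('n::enum) \<Longrightarrow> vec_list (list_vec xs :: real ^ 'n::enum) = xs"
  by (intro nth_equalityI) (auto simp: rspace_def vec_list_def list_vec_def length_enum enum_index_nth)

lemma sum_enum_index: "(\<Sum>i\<in>UNIV. g (enum_index (i :: 'n::enum))) = (\<Sum>k<CARD('n). g k)"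
proof -
  have "(\<Sum>k<CARD('n). g (enum_index ((Enum.enum :: 'n list) ! k))) = (\<Sum>i\<in>UNIV. g (enum_index (i :: 'n)))"
    by (rule sum.reindex_bij_betw[OF bij_betw_enum_nth])
  then show ?thesis by (simp add: enum_index_nth)
qed

lemma norm_enum_vec:
  fixes g :: "nat \<Rightarrow> real"
  shows "(norm (\<chi> i :: 'n::enum. g (enum_index i)))\<^sup>2 = (\<Sum>k<CARD('n). (g k)\<^sup>2)"
  unfolding power2_norm_eq_inner inner_vec_def
  by (simp add: sum_enum_index[of "\<lambda>k. g k * g k"] power2_eq_square)

lemma has_vector_derivative_enum_vec:
  assumes "\<And>k. k < CARD('n::enum) \<Longrightarrow> (g k has_real_derivative g' k) (at t)"
  shows "((\<lambda>t. \<chi> i :: 'n. g (enum_index i) t) has_vector_derivative (\<chi> i. g' (enum_index i))) (at t)"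
  unfolding has_vector_derivative_def
proof (subst has_derivative_componentwise_within, rule ballI)
  fix b :: "real ^ 'n::enum" assume "b \<in> Basis"
  then obtain i and u :: real where "b = axis i u" "u \<in> Basis"
    unfolding Basis_vec_def by blast
  then have b: "b = axis i 1" by simp
  have "(g (enum_index i) has_derivative (\<lambda>h. h * g' (enum_index i))) (at t)"
    by (rule has_derivative_eq_rhs[OF assms[OF enum_index_less[of i], unfolded has_field_derivative_def]])
      (simp add: fun_eq_iff)
  then show "((\<lambda>x. (\<chi> i. g (enum_index i) x) \<bullet> b) has_derivative
      (\<lambda>x. (x *\<^sub>R (\<chi> i. g' (enum_index i))) \<bullet> b)) (at t)"
    by (simp add: b inner_axis)
qed

text \<open>A maximum yields only lower bounds for the increments of \<open>f\<close>, so the curve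
  is traversed in the direction in which \<open>f\<close> decreases: forwards for
  \<open>\<sigma> = -1\<close>, backwards for \<open>\<sigma> = 1\<close>. The decrease has rate 1,
  and the rate is at most \<open>c\<close>.\<close>

lemma conservative_field_slope:
  fixes f :: "real ^ 'n \<Rightarrow> real" and \<gamma> :: "real \<Rightarrow> real ^ 'n"
  assumes cons: "conservative_field_for D f" and "a < b"
    and deriv: "\<And>t. a \<le> t \<Longrightarrow> t \<le> b \<Longrightarrow> (\<gamma> has_vector_derivative \<gamma>' t) (at t)"
    and cont: "continuous_on {a..b} \<gamma>'"
    and v: "\<And>t. a \<le> t \<Longrightarrow> t \<le> b \<Longrightarrow> v t \<in> D (\<gamma> t) \<and> norm (\<gamma>' t) * norm (v t) \<le> c"
    and f: "\<And>t. a \<le> t \<Longrightarrow> t \<le> b \<Longrightarrow> f (\<gamma> t) = \<sigma> * t" and \<sigma>: "\<sigma> = 1 \<or> \<sigma> = -1"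
  shows "1 \<le> c"
  using \<sigma>
proof
  assume "\<sigma> = -1"
  have "- c * (b - a) \<le> f (\<gamma> b) - f (\<gamma> a)"
    by (rule conservative_field_decrease[OF cons \<open>a < b\<close> deriv cont v])
  then have "1 * (b - a) \<le> c * (b - a)" using f \<open>a < b\<close> \<open>\<sigma> = -1\<close> by (simp add: algebra_simps)
  then show ?thesis using \<open>a < b\<close> by (elim mult_right_le_imp_le) simp
next
  assume "\<sigma> = 1"
  have "- c * (- a - - b) \<le> f (\<gamma> (- (- a))) - f (\<gamma> (- (- b)))"
  proof (rule conservative_field_decrease[OF cons, of "-b" "-a" "\<lambda>t. \<gamma> (- t)" "\<lambda>t. - \<gamma>' (- t)" "\<lambda>t. v (- t)"])
    fix t assume t: "- b \<le> t" "t \<le> - a"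
    have m: "(uminus has_vector_derivative (-1::real)) (at t)"
      by (auto intro!: derivative_eq_intros simp: has_real_derivative_iff_has_vector_derivative[symmetric])
    have "(\<gamma> has_vector_derivative \<gamma>' (- t)) (at (- t))" using t by (intro deriv) auto
    from vector_diff_chain_at[OF m this]
    show "((\<lambda>t. \<gamma> (- t)) has_vector_derivative - \<gamma>' (- t)) (at t)" by (simp add: o_def)
    show "v (- t) \<in> D (\<gamma> (- t)) \<and> norm (- \<gamma>' (- t)) * norm (v (- t)) \<le> c" using v[of "-t"] t by simp
  next
    show "continuous_on {- b..- a} (\<lambda>t. - \<gamma>' (- t))"
      by (intro continuous_intros continuous_on_compose2[OF cont]) auto
  qed (use \<open>a < b\<close> in auto)
  then have "1 * (b - a) \<le> c * (b - a)" using f \<open>a < b\<close> \<open>\<sigma> = 1\<close> by (simp add: algebra_simps)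
  then show ?thesis using \<open>a < b\<close> by (elim mult_right_le_imp_le) simp
qed

text \<open>\<open>B t - ln t / 2\<close> would be nondecreasing, although \<open>B\<close> is
  bounded and \<open>ln\<close> is unbounded near 0.\<close>

lemma bounded_log_derivative_contradiction:
  fixes B B' :: "real \<Rightarrow> real"
  assumes "d > 0" and bound: "\<And>t. 0 < t \<Longrightarrow> t < d \<Longrightarrow> \<bar>B t\<bar> \<le> M"
    and deriv: "\<And>t. 0 < t \<Longrightarrow> t < d \<Longrightarrow> (B has_real_derivative B' t) (at t)"
    and large: "\<And>t. 0 < t \<Longrightarrow> t < d \<Longrightarrow> 1/2 < t * B' t"
  shows False
proof -
  define b where "b = d / 2"
  \<comment> \<open>From \<open>a\<close> to \<open>b\<close> the logarithm grows by
    \<open>4 * M + 2\<close>, so \<open>B\<close> would grow by at least \<open>2 * M + 1\<close>,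
    more than the bound \<open>M\<close> on its absolute value permits.\<close>
  define a where "a = b * exp (- (4 * M + 2))"
  have "0 \<le> M" using bound[of b] \<open>d > 0\<close> by (force simp: b_def)
  have ab: "0 < a" "a < b" "b < d"
    using \<open>d > 0\<close> \<open>0 \<le> M\<close> by (auto simp: a_def b_def)
  have "B a - ln a / 2 \<le> B b - ln b / 2"
  proof (rule DERIV_nonneg_imp_nondecreasing[where f = "\<lambda>t. B t - ln t / 2"])
    fix x assume x: "a \<le> x" "x \<le> b"
    then have "((\<lambda>t. B t - ln t / 2) has_real_derivative B' x - 1 / x / 2) (at x)"
      using ab by (auto intro!: derivative_eq_intros deriv)
    moreover have "0 \<le> B' x - 1 / x / 2"
      using large[of x] x ab by (simp add: field_simps)
    ultimately show "\<exists>y. ((\<lambda>t. B t - ln t / 2) has_real_derivative y) (at x) \<and> 0 \<le> y" by blast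
  qed (use ab in simp)
  moreover have "ln a = ln b - (4 * M + 2)" using ab by (simp add: a_def ln_mult)
  ultimately have "B a + (2 * M + 1) \<le> B b" by argo
  moreover have "\<bar>B a\<bar> \<le> M" "\<bar>B b\<bar> \<le> M" using bound ab by auto
  ultimately show False by linarith
qed

lemma has_real_derivative_over_sqrt:
  fixes g :: "real \<Rightarrow> real"
  assumes "(g has_real_derivative T) (at t)"
  shows "((\<lambda>t. g t / sqrt (1 + (g t)\<^sup>2)) has_real_derivative
      T / ((1 + (g t)\<^sup>2) * sqrt (1 + (g t)\<^sup>2))) (at t)"
proof -
  let ?r = "sqrt (1 + (g t)\<^sup>2)"
  have r: "?r > 0" "?r\<^sup>2 = 1 + (g t)\<^sup>2" "1 + (g t)\<^sup>2 > 0"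
    by (auto simp: add_pos_nonneg)
  have "((\<lambda>t. sqrt (1 + (g t)\<^sup>2)) has_real_derivative (g t * T) / ?r) (at t)"
    using r by (auto intro!: derivative_eq_intros assms simp: field_simps)
  then have "((\<lambda>t. g t / sqrt (1 + (g t)\<^sup>2)) has_real_derivative
      (T * ?r - g t * ((g t * T) / ?r)) / (?r * ?r)) (at t)"
    using r by (intro DERIV_divide assms) auto
  also have "(T * ?r - g t * ((g t * T) / ?r)) / (?r * ?r) = T * (?r\<^sup>2 - (g t)\<^sup>2) / (?r * (?r * ?r))"
    using r(1) by (simp add: field_simps power2_eq_square)
  also have "\<dots> = T / ((1 + (g t)\<^sup>2) * ?r)"
  proof -
    have e: "?r\<^sup>2 - (g t)\<^sup>2 = 1" using r(2) by linarith
    have "?r * ?r = 1 + (g t)\<^sup>2" using r(2) by (simp only: power2_eq_square)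
    then show ?thesis unfolding e by (simp only: mult_1_right mult.commute)
  qed
  finally show ?thesis .
qed

lemma abs_over_sqrt_le_1: "\<bar>u / sqrt (1 + u\<^sup>2)\<bar> \<le> (1::real)"
proof -
  have "\<bar>u\<bar> \<le> sqrt (1 + u\<^sup>2)" by (rule real_le_rsqrt) simp
  moreover have "0 < sqrt (1 + u\<^sup>2)" by (simp add: add_pos_nonneg)
  ultimately show ?thesis by (simp add: abs_divide divide_le_eq)
qed

context o_minimal_structure
begin

section \<open>Definability of functions and set-valued maps in coordinates\<close>

lemma definable_fun_deffun:
  fixes f :: "real ^ 'n::enum \<Rightarrow> real"
  assumes "definable_fun S f"
  shows "deffun CARD('n) (\<lambda>xs. f (list_vec xs))"
proof -
  have "{z \<in> rspace (Suc CARD('n)). last z = f (list_vec (butlast z))} = {vec_list x @ [f x] |x. True}"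
  proof (intro subset_antisym subsetI)
    fix z assume "z \<in> {z \<in> rspace (Suc CARD('n)). last z = f (list_vec (butlast z))}"
    then obtain xs where "z = xs @ [f (list_vec xs)]" "xs \<in> rspace CARD('n)"
      by (auto simp: rspace_Suc)
    then have "z = vec_list (list_vec xs :: real ^ 'n::enum) @ [f (list_vec xs)]"
      by (simp add: vec_list_list_vec)
    then show "z \<in> {vec_list x @ [f x] |x. True}" by blast
  qed (auto simp: rspace_def length_vec_list list_vec_vec_list)
  then show ?thesis using assms by (simp add: deffun_def defpred_def definable_fun_def)
qed

lemma definable_setmap_defpred:
  fixes D :: "real ^ 'n::enum \<Rightarrow> (real ^ 'n::enum) set"
  assumes "definable_setmap S D"
  shows "defpred (CARD('n) + CARD('n)) (\<lambda>z. list_vec (drop CARD('n) z) \<in> D (list_vec (take CARD('n) z)))"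
proof -
  have "{z \<in> rspace (CARD('n) + CARD('n)). list_vec (drop CARD('n) z) \<in> D (list_vec (take CARD('n) z))}
      = {vec_list x @ vec_list v |x v. v \<in> D x}"
  proof (intro subset_antisym subsetI)
    fix z assume z: "z \<in> {z \<in> rspace (CARD('n) + CARD('n)). list_vec (drop CARD('n) z) \<in> D (list_vec (take CARD('n) z))}"
    let ?x = "list_vec (take CARD('n) z) :: real ^ 'n::enum" and ?v = "list_vec (drop CARD('n) z) :: real ^ 'n::enum"
    have "vec_list ?x = take CARD('n) z" "vec_list ?v = drop CARD('n) z"
      using z by (auto intro!: vec_list_list_vec simp: rspace_def)
    then have "z = vec_list ?x @ vec_list ?v" by simp
    moreover have "?v \<in> D ?x" using z by simp
    ultimately show "z \<in> {vec_list x @ vec_list v |x v. v \<in> D x}" by blast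
  qed (auto simp: rspace_def length_vec_list list_vec_vec_list)
  then show ?thesis using assms by (simp add: defpred_def definable_setmap_def)
qed

section \<open>The weighted inequality and its consequence\<close>

text \<open>The sign \<open>s\<close> makes \<open>s * g\<close> nondecreasing near 0. In a sum over
  coordinates, the absolute values of derivatives thereby become the derivative of a single
  function.\<close>

definition C1_germ :: "(real \<Rightarrow> real) \<Rightarrow> (real \<Rightarrow> real) \<Rightarrow> real \<Rightarrow> real \<Rightarrow> bool" where
  "C1_germ g T d s \<longleftrightarrow> definable1 T \<and> d > 0 \<and> (s = 1 \<or> s = -1) \<and>
    (\<forall>x. 0 < x \<and> x < d \<longrightarrow> (g has_real_derivative T x) (at x) \<and> isCont T x \<and> s * T x = \<bar>T x\<bar>)"

lemma definable1_C1_germ: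
  assumes "definable1 g"
  shows "\<exists>T d s. C1_germ g T d s"
proof (rule definable1_germ_C1[OF assms])
  fix T d
  assume T: "definable1 T" "d > 0"
    "\<And>x. 0 < x \<Longrightarrow> x < d \<Longrightarrow> (g has_real_derivative T x) (at x)"
    "\<And>x. 0 < x \<Longrightarrow> x < d \<Longrightarrow> isCont T x"
    "(\<forall>x. 0 < x \<and> x < d \<longrightarrow> 0 \<le> T x) \<or> (\<forall>x. 0 < x \<and> x < d \<longrightarrow> T x \<le> 0)"
  from T(5) show ?thesis
  proof
    assume "\<forall>x. 0 < x \<and> x < d \<longrightarrow> 0 \<le> T x"
    then have "C1_germ g T d 1" using T unfolding C1_germ_def by auto
    then show ?thesis by blast
  next
    assume "\<forall>x. 0 < x \<and> x < d \<longrightarrow> T x \<le> 0"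
    then have "C1_germ g T d (-1)" using T unfolding C1_germ_def by auto
    then show ?thesis by blast
  qed
qed

text \<open>Near-minimality transfers the estimate from the chosen curve to every pair
  \<open>(x, v)\<close> of the graph on the same level of \<open>\<bar>f\<bar>\<close>: it reads
  \<open>1 \<le> 16 * q * (B' t)\<^sup>2\<close> for all values \<open>q\<close> of the squared
  weighted norm on level \<open>t\<close>. The function \<open>\<phi>\<close> obtained here is the
  \<psi> of the overview.\<close>

lemma global_desingularization:
  fixes D :: "real ^ 'p::enum \<Rightarrow> (real ^ 'p::enum) set" and f :: "real ^ 'p::enum \<Rightarrow> real"
  assumes cons: "conservative_field_for D f" and f: "definable_fun S f" and D: "definable_setmap S D"
  shows "\<exists>\<delta>>0. \<exists>\<phi> R. definable1 \<phi> \<and> \<phi> 0 = 0 \<and> (\<phi> \<longlongrightarrow> 0) (at_right 0) \<and>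
    (\<forall>t. 0 < t \<and> t < \<delta> \<longrightarrow> (\<phi> has_real_derivative R t) (at t) \<and> isCont R t \<and> 0 < R t) \<and>
    (\<forall>x. \<forall>v\<in>D x. 0 < \<bar>f x\<bar> \<and> \<bar>f x\<bar> < \<delta> \<longrightarrow> 1 \<le> norm v * (1 + (norm x)\<^sup>2)\<^sup>2 * R \<bar>f x\<bar>)"
proof -
  define N where "N = CARD('p)"
  define F where "F xs = f (list_vec xs)" for xs
  define nsq where "nsq xs = (\<Sum>k<N. (xs ! k)\<^sup>2)" for xs :: "real list"
  define wt where "wt xs = (1 + nsq xs)\<^sup>2" for xs
  \<comment> \<open>The squared weighted norm of v at x, for \<open>z\<close> the concatenation of x
    and v; squaring keeps it polynomial in the coordinates.\<close>
  define Q where "Q z = nsq (drop N z) * (wt (take N z))\<^sup>2" for z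
  define Gr where "Gr z \<longleftrightarrow> list_vec (drop N z) \<in> D (list_vec (take N z))" for z
  define W where "W t q \<longleftrightarrow> (\<exists>z\<in>rspace (N + N). Gr z \<and> \<bar>F (take N z)\<bar> = t \<and> Q z = q)" for t q
  have nsq_norm: "nsq xs = (norm (list_vec xs :: real ^ 'p::enum))\<^sup>2" for xs
    unfolding list_vec_def norm_enum_vec nsq_def N_def ..
  have nsq_nonneg: "0 \<le> nsq xs" for xs by (simp add: nsq_def sum_nonneg)
  have Q_nonneg: "0 \<le> Q z" for z by (simp add: Q_def nsq_nonneg)
  have dF: "deffun N F" unfolding F_def N_def by (rule definable_fun_deffun[OF f])
  have dGr: "defpred (N + N) Gr" unfolding Gr_def N_def by (rule definable_setmap_defpred[OF D])
  have dnsq: "deffun N nsq" unfolding nsq_def by (intro deffun_sum deffun_power deffun_nth) simp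
  have dnsq': "deffun k (\<lambda>z. nsq (L z))" if "deflist k N L" for k L
    by (rule deffun_deflist[OF dnsq that])
  have dwt: "deffun k (\<lambda>z. wt (L z))" if "deflist k N L" for k L
    unfolding wt_def by (intro definability dnsq' that)
  have dQ: "deffun k (\<lambda>z. Q (L z))" if "deflist k (N + N) L" for k L
  proof -
    have "deflist k N (\<lambda>z. take N (L z))" by (rule deflist_take[OF that]) simp
    moreover have "deflist k N (\<lambda>z. drop N (L z))" by (rule deflist_drop[OF that])
    ultimately show ?thesis unfolding Q_def by (intro definability dnsq' dwt)
  qed
  have dF': "deffun k (\<lambda>z. F (take N (L z)))" if "deflist k (N + N) L" for k L
    by (intro deffun_deflist[OF dF] deflist_take[OF that]) simp
  have dW: "defpred (Suc (Suc 0)) (\<lambda>y. W (last (butlast y)) (last y))"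
    unfolding W_def
  proof (rule defpred_ex_list)
    let ?k = "Suc (Suc 0) + (N + N)"
    have z: "deflist ?k (N + N) (drop (Suc (Suc 0)))" by (rule deflist_drop[OF deflist_id])
    have y: "deflist ?k (Suc (Suc 0)) (take (Suc (Suc 0)))" by (rule deflist_take[OF deflist_id]) simp
    have "deffun (Suc (Suc 0)) (\<lambda>y. last (butlast y))" by (intro deffun_butlast deffun_last)
    from deffun_deflist[OF this y] deffun_deflist[OF deffun_last y]
    show "defpred ?k (\<lambda>z. Gr (drop (Suc (Suc 0)) z) \<and>
        \<bar>F (take N (drop (Suc (Suc 0)) z))\<bar> = last (butlast (take (Suc (Suc 0)) z)) \<and>
        Q (drop (Suc (Suc 0)) z) = last (take (Suc (Suc 0)) z))"
      by (intro defpred_conj defpred_eq deffun_abs defpred_deflist[OF dGr] dF' dQ z)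
  qed
  \<comment> \<open>The infimum of \<open>Q\<close> over a level need not be attained and may be 0,
    so an additive slack is allowed. The choice t^2 is small enough to be absorbed later through
    \<open>t * B' t \<le> 1/2\<close>.\<close>
  define K where "K y \<longleftrightarrow> Gr (drop 1 y) \<and> \<bar>F (take N (drop 1 y))\<bar> = y ! 0 \<and>
      (\<forall>q. W (y ! 0) q \<longrightarrow> Q (drop 1 y) \<le> 4 * q + (y ! 0)\<^sup>2)" for y
  have "defpred (1 + (N + N)) K"
  proof -
    have z: "deflist (1 + (N + N)) (N + N) (drop 1)" by (rule deflist_drop[OF deflist_id])
    have y: "deffun (1 + (N + N)) (\<lambda>y. y ! 0)" by (rule deffun_nth) simp
    show ?thesis
      unfolding K_def
      by (intro defpred_conj defpred_eq deffun_abs defpred_deflist[OF dGr] dF' z y defpred_all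
          defpred_imp defpred_rel2[OF dW] defpred_le deffun_add deffun_mult deffun_const
          deffun_power deffun_last deffun_butlast dQ deflist_butlast)
  qed
  from definable_choice[OF this] obtain L where L: "deflist 1 (N + N) L"
    and KL: "\<And>x. x \<in> rspace 1 \<Longrightarrow> \<exists>y\<in>rspace (N + N). K (x @ y) \<Longrightarrow> K (x @ L x)" by blast
  define Z where "Z t = L [t]" for t
  have rspace1: "x \<in> rspace (Suc 0) \<Longrightarrow> [last x] = x" for x :: "real list"
    by (auto simp: rspace_def length_Suc_conv)
  have dZ: "deflist (Suc 0) (N + N) (\<lambda>x. Z (last x))"
  proof -
    have "deffun (Suc 0) (\<lambda>x. L [last x] ! i)" if "i < N + N" for i
    proof -
      have "deffun (Suc 0) (\<lambda>x. L x ! i)" using L that by (simp add: deflist_def)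
      also have "?this \<longleftrightarrow> ?thesis" by (rule deffun_cong) (simp add: rspace1)
      finally show ?thesis .
    qed
    moreover have "L [last x] \<in> rspace (N + N)" if "x \<in> rspace (Suc 0)" for x
      using L that by (simp add: deflist_def rspace1)
    ultimately show ?thesis by (simp add: deflist_def Z_def)
  qed
  have KZ: "K ([t] @ Z t)" if "0 < t" "W t q0" for t q0
  proof -
    have "bdd_below {q. W t q}" using Q_nonneg by (auto simp: W_def bdd_below_def)
    moreover have "{q. W t q} \<noteq> {}" using that(2) by blast
    ultimately have inf: "Inf {q. W t q} \<le> q" if "W t q" for q
      using that by (intro cInf_lower) auto
    have "\<exists>q\<in>{q. W t q}. q < Inf {q. W t q} + t\<^sup>2"
      using \<open>{q. W t q} \<noteq> {}\<close> that(1) by (intro cInf_lessD) auto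
    then obtain q where q: "W t q" "q < Inf {q. W t q} + t\<^sup>2" by blast
    then obtain z where z: "z \<in> rspace (N + N)" "Gr z" "\<bar>F (take N z)\<bar> = t" "Q z = q"
      by (auto simp: W_def)
    have "Q z \<le> 4 * q' + t\<^sup>2" if "W t q'" for q'
    proof -
      have "0 \<le> q'" using that Q_nonneg by (auto simp: W_def)
      then show ?thesis using inf[OF that] q(2) z(4) by simp
    qed
    then have "K ([t] @ z)" using z by (simp add: K_def)
    then show ?thesis using KL[of "[t]"] z(1) by (auto simp: Z_def rspace_def)
  qed
  have dex: "defset (\<lambda>t. \<exists>q. W t q)"
    by (intro defpred_ex defpred_rel2[OF dW] deffun_butlast deffun_last)
  show ?thesis
  \<comment> \<open>If small positive levels of \<open>\<bar>f\<bar>\<close> carry no point of the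
    graph, the inequality is vacuous and the identity serves as \<open>\<phi>\<close>.\<close>
  proof (cases "\<forall>\<^sub>F t in at_right 0. \<not> (\<exists>q. W t q)")
    case True
    then obtain \<delta> where \<delta>: "\<delta> > 0" "\<And>t. 0 < t \<Longrightarrow> t < \<delta> \<Longrightarrow> \<not> (\<exists>q. W t q)"
      by (auto simp: eventually_at_right_field)
    have False if "v \<in> D x" "0 < \<bar>f x\<bar>" "\<bar>f x\<bar> < \<delta>" for x v
    proof -
      let ?z = "vec_list x @ vec_list v"
      have "?z \<in> rspace (N + N)" "Gr ?z" "\<bar>F (take N ?z)\<bar> = \<bar>f x\<bar>"
        using that(1) by (simp_all add: rspace_def Gr_def F_def length_vec_list list_vec_vec_list N_def)
      then have "W \<bar>f x\<bar> (Q ?z)" unfolding W_def by blast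
      then show False using \<delta>(2) that by blast
    qed
    moreover have "((\<lambda>t::real. t) \<longlongrightarrow> 0) (at_right 0)" by (rule tendsto_ident_at)
    ultimately show ?thesis
      using \<delta>(1) by (intro exI[of _ \<delta>] conjI exI[of _ "\<lambda>t. t"] exI[of _ "\<lambda>t. 1"])
        (auto intro: deffun_last)
  next
    case False
    then have "\<forall>\<^sub>F t in at_right 0. \<exists>q. W t q" using defset_germ_0[OF dex] by blast
    then obtain d0 where d0: "d0 > 0" "\<And>t. 0 < t \<Longrightarrow> t < d0 \<Longrightarrow> \<exists>q. W t q"
      by (auto simp: eventually_at_right_field)
    have dZ0: "definable1 (\<lambda>t. Z t ! k)" if "k < N" for k
      using dZ that by (simp add: deflist_def)
    have "\<exists>T d s. C1_germ (\<lambda>t. Z t ! k) T d s" if "k < N" for k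
      by (rule definable1_C1_germ[OF dZ0[OF that]])
    then obtain T d s where germ: "\<And>k. k < N \<Longrightarrow> C1_germ (\<lambda>t. Z t ! k) (T k) (d k) (s k)"
      by metis
    have dT: "definable1 (T k)" if "k < N" for k using germ[OF that] by (simp add: C1_germ_def)
    define d1 where "d1 = Min (insert d0 (d ` {..<N}))"
    have d1: "d1 > 0" "d1 \<le> d0" "\<And>k. k < N \<Longrightarrow> d1 \<le> d k"
      using d0(1) germ by (auto simp: d1_def C1_germ_def)
    have dZk: "((\<lambda>t. Z t ! k) has_real_derivative T k t) (at t)" and Tcont: "isCont (T k) t"
      and sT: "s k * T k t = \<bar>T k t\<bar>" if "k < N" "0 < t" "t < d1" for k t
      using germ[OF that(1)] that d1(3)[OF that(1)] by (auto simp: C1_germ_def)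
    have s1: "\<bar>s k\<bar> = 1" if "k < N" for k using germ[OF that] by (auto simp: C1_germ_def)
    define r where "r k t = sqrt (1 + (Z t ! k)\<^sup>2)" for k t
    \<comment> \<open>The sum of the compressed coordinates, each with the sign that makes it
      nondecreasing. It is bounded by \<open>N\<close>, and its derivative \<open>B'\<close> is the
      sum of the absolute speeds.\<close>
    define B where "B t = (\<Sum>k<N. s k * (Z t ! k / r k t))" for t
    define B' where "B' t = (\<Sum>k<N. \<bar>T k t\<bar> / ((1 + (Z t ! k)\<^sup>2) * r k t))" for t
    have r_pos: "r k t > 0" for k t by (simp add: r_def add_pos_nonneg)
    have dr: "definable1 (r k)" if "k < N" for k
    proof -
      have "definable1 (\<lambda>t. sqrt \<bar>1 + (Z t ! k)\<^sup>2\<bar>)"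
        by (intro deffun_sqrt_abs definability dZ0 that)
      then show ?thesis by (simp add: r_def)
    qed
    have dB: "definable1 B"
      unfolding B_def by (intro deffun_sum definability dr dZ0) auto
    have dB': "definable1 B'"
      unfolding B'_def by (intro deffun_sum definability dr dT dZ0) auto
    have B'_nonneg: "0 \<le> B' t" for t
      unfolding B'_def using r_pos by (intro sum_nonneg divide_nonneg_pos mult_pos_pos) (auto simp: add_pos_nonneg)
    have B_bound: "\<bar>B t\<bar> \<le> N" for t
    proof -
      have "\<bar>B t\<bar> \<le> (\<Sum>k<N. \<bar>s k * (Z t ! k / r k t)\<bar>)" unfolding B_def by (rule sum_abs)
      also have "\<dots> \<le> (\<Sum>k<N. 1)"
        using s1 abs_over_sqrt_le_1 by (intro sum_mono) (simp add: r_def abs_mult)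
      finally show ?thesis by simp
    qed
    have B_deriv: "(B has_real_derivative B' t) (at t)" if t: "0 < t" "t < d1" for t
      unfolding B_def B'_def
    proof (rule DERIV_sum)
      fix k assume "k \<in> {..<N}"
      then have k: "k < N" by simp
      have "((\<lambda>t. s k * (Z t ! k / r k t)) has_real_derivative
          s k * (T k t / ((1 + (Z t ! k)\<^sup>2) * r k t))) (at t)"
        unfolding r_def by (intro DERIV_cmult has_real_derivative_over_sqrt dZk k t)
      then show "((\<lambda>t. s k * (Z t ! k / r k t)) has_real_derivative
          \<bar>T k t\<bar> / ((1 + (Z t ! k)\<^sup>2) * r k t)) (at t)"
        using sT[OF k t] by simp
    qed
    have B'_cont: "isCont B' t" if t: "0 < t" "t < d1" for t
    proof -
      have "isCont (\<lambda>t. Z t ! k) t" if "k < N" for k by (rule DERIV_isCont[OF dZk[OF that t]])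
      moreover have "(1 + (Z t ! k)\<^sup>2) * r k t \<noteq> 0" for k
        using r_pos[of k t] by (auto simp: add_pos_nonneg less_imp_neq[symmetric])
      ultimately show ?thesis
        unfolding B'_def using Tcont t by (intro continuous_intros) (auto simp: r_def intro!: continuous_intros)
    qed

    define V where "V t = nsq (drop N (Z t))" for t
    define n2 where "n2 t = (\<Sum>k<N. (T k t)\<^sup>2)" for t
    \<comment> \<open>Along the curve \<open>f\<close> is known only up to sign; once the sign is
      constant near 0, \<open>f\<close> equals \<open>t\<close> or \<open>- t\<close> there.\<close>
    have "defset (\<lambda>t. 0 < F (take N (Z t)))"
      by (intro definability dF' dZ)
    then obtain pos where "\<forall>\<^sub>F t in at_right 0. (0 < F (take N (Z t))) = pos"
      by (rule defset_germ_constant)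
    then obtain d2 where d2: "d2 > 0" "\<And>t. 0 < t \<Longrightarrow> t < d2 \<Longrightarrow> (0 < F (take N (Z t))) = pos"
      by (auto simp: eventually_at_right_field)
    have KZt: "Gr (Z t)" "\<bar>F (take N (Z t))\<bar> = t" "\<And>q. W t q \<Longrightarrow> Q (Z t) \<le> 4 * q + t\<^sup>2"
      if t: "0 < t" "t < d1" for t
    proof -
      obtain q0 where "W t q0" using d0(2)[of t] t d1(2) by auto
      from KZ[OF t(1) this]
      show "Gr (Z t)" "\<bar>F (take N (Z t))\<bar> = t" "\<And>q. W t q \<Longrightarrow> Q (Z t) \<le> 4 * q + t\<^sup>2"
        by (simp_all add: K_def)
    qed
    \<comment> \<open>\<open>V\<close> and \<open>n2\<close> are the squared norms of \<nu> and of
      the derivative of \<theta>. If \<open>V * n2 < 1/2\<close> held for all small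
      \<open>t\<close>, the product of the norms would be at most 3/4 on a whole interval, as 1/2
      \<le> 9/16, against \<open>conservative_field_slope\<close>.\<close>
    have "defset (\<lambda>t. 1 \<le> 2 * V t * n2 t)"
      unfolding V_def n2_def by (intro definability deffun_sum dnsq' deflist_drop dZ dT) simp
    from defset_germ_0[OF this] have "\<forall>\<^sub>F t in at_right 0. 1 \<le> 2 * V t * n2 t"
    proof
      assume "\<forall>\<^sub>F t in at_right 0. \<not> 1 \<le> 2 * V t * n2 t"
      then obtain d3 where d3: "d3 > 0" "\<And>t. 0 < t \<Longrightarrow> t < d3 \<Longrightarrow> 2 * V t * n2 t < 1"
        by (auto simp: eventually_at_right_field not_le)
      define b where "b = min d1 (min d2 d3) / 2"
      have b: "0 < b" "b < d1" "b < d2" "b < d3" using d1(1) d2(1) d3(1) by (auto simp: b_def)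
      define \<theta> where "\<theta> t = (list_vec (take N (Z t)) :: real ^ 'p::enum)" for t
      define \<theta>' where "\<theta>' t = (\<chi> i :: 'p. T (enum_index i) t)" for t
      define \<nu> where "\<nu> t = (list_vec (drop N (Z t)) :: real ^ 'p::enum)" for t
      have idx: "enum_index (i :: 'p) < N" for i by (simp add: N_def enum_index_less)
      have \<theta>_eq: "\<theta> = (\<lambda>t. \<chi> i :: 'p. Z t ! enum_index i)"
        by (rule ext) (simp add: \<theta>_def list_vec_def idx)
      have "1 \<le> (3/4 :: real)"
      proof (rule conservative_field_slope[OF cons])
        show "b / 2 < b" using b by simp
        show "(\<theta> has_vector_derivative \<theta>' t) (at t)" if "b / 2 \<le> t" "t \<le> b" for t
          unfolding \<theta>_eq \<theta>'_def using that b
          by (intro has_vector_derivative_enum_vec[where g = "\<lambda>k t. Z t ! k" and g' = "\<lambda>k. T k t"] dZk)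
            (auto simp: N_def)
        show "continuous_on {b / 2..b} \<theta>'"
          unfolding \<theta>'_def using b idx
          by (intro continuous_on_vec_lambda continuous_at_imp_continuous_on ballI Tcont) auto
        show "f (\<theta> t) = (if pos then 1 else -1) * t" if "b / 2 \<le> t" "t \<le> b" for t
          using KZt(2)[of t] d2(2)[of t] that b by (auto simp: F_def \<theta>_def split: if_splits)
        show "(if pos then 1 else -1) = 1 \<or> (if pos then 1 else -1) = (-1 :: real)" by simp
        show "\<nu> t \<in> D (\<theta> t) \<and> norm (\<theta>' t) * norm (\<nu> t) \<le> 3/4" if t: "b / 2 \<le> t" "t \<le> b" for t
        proof
          show "\<nu> t \<in> D (\<theta> t)" using KZt(1)[of t] t b by (simp add: Gr_def \<nu>_def \<theta>_def)
          have "(norm (\<theta>' t))\<^sup>2 = n2 t"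
            unfolding \<theta>'_def n2_def N_def by (rule norm_enum_vec[of "\<lambda>k. T k t"])
          moreover have "(norm (\<nu> t))\<^sup>2 = V t" unfolding V_def nsq_norm \<nu>_def ..
          ultimately have "(norm (\<theta>' t) * norm (\<nu> t))\<^sup>2 = V t * n2 t"
            by (simp add: power_mult_distrib)
          also have "\<dots> \<le> (3/4)\<^sup>2" using d3(2)[of t] t b by (simp add: power2_eq_square)
          finally show "norm (\<theta>' t) * norm (\<nu> t) \<le> 3/4" by (rule power2_le_imp_le) simp
        qed
      qed
      then show ?thesis by simp
    qed
    then obtain d4 where d4: "d4 > 0" "\<And>t. 0 < t \<Longrightarrow> t < d4 \<Longrightarrow> 1 \<le> 2 * V t * n2 t"
      by (auto simp: eventually_at_right_field)
    \<comment> \<open>This controls the slack in \<open>K\<close>: multiplied by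
      \<open>(B' t)\<^sup>2\<close> it becomes \<open>(t * B' t)\<^sup>2\<close>, at most
      1/4.\<close>
    have "defset (\<lambda>t. t * B' t \<le> 1/2)"
      by (intro definability dB')
    from defset_germ_0[OF this] have "\<forall>\<^sub>F t in at_right 0. t * B' t \<le> 1/2"
    proof
      assume "\<forall>\<^sub>F t in at_right 0. \<not> t * B' t \<le> 1/2"
      then obtain d5 where d5: "d5 > 0" "\<And>t. 0 < t \<Longrightarrow> t < d5 \<Longrightarrow> 1/2 < t * B' t"
        by (auto simp: eventually_at_right_field not_le)
      have False
        by (rule bounded_log_derivative_contradiction[of "min d1 d5" B N B'])
          (use d1(1) d5 B_bound B_deriv in auto)
      then show ?thesis ..
    qed
    then obtain d5 where d5: "d5 > 0" "\<And>t. 0 < t \<Longrightarrow> t < d5 \<Longrightarrow> t * B' t \<le> 1/2"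
      by (auto simp: eventually_at_right_field)

    define \<delta> where "\<delta> = min d1 (min d4 d5)"
    have \<delta>: "\<delta> > 0" "\<delta> \<le> d1" "\<delta> \<le> d4" "\<delta> \<le> d5"
      using d1(1) d4(1) d5(1) by (auto simp: \<delta>_def)
    have weighted: "1 \<le> 16 * q * (B' t)\<^sup>2" if t: "0 < t" "t < \<delta>" and q: "W t q" for t q
    proof -
      let ?x = "take N (Z t)"
      \<comment> \<open>With a = 1 + Z_k^2 one has a * sqrt a \<le> a^2 \<le> wt, so the weight
        outweighs the compression of each coordinate.\<close>
      have "\<bar>T k t\<bar> \<le> wt ?x * (\<bar>T k t\<bar> / ((1 + (Z t ! k)\<^sup>2) * r k t))" if k: "k < N" for k
      proof -
        define a where "a = 1 + (Z t ! k)\<^sup>2"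
        have "(?x ! k)\<^sup>2 \<le> nsq ?x"
          unfolding nsq_def using k by (intro member_le_sum) auto
        then have a: "1 \<le> a" "a \<le> 1 + nsq ?x" using k by (auto simp: a_def)
        have "r k t \<le> a"
          unfolding r_def a_def[symmetric] using a(1) by (intro real_le_lsqrt) (auto simp: power2_eq_square)
        then have "a * r k t \<le> a * a" using a by (intro mult_left_mono) auto
        also have "\<dots> \<le> wt ?x" using a by (auto simp: wt_def power2_eq_square intro!: mult_mono)
        finally have "a * r k t \<le> wt ?x" .
        moreover have "0 < a * r k t" using a(1) r_pos by (intro mult_pos_pos) auto
        ultimately have "1 \<le> wt ?x / (a * r k t)" by (simp add: le_divide_eq_1)
        then have "1 * \<bar>T k t\<bar> \<le> wt ?x / (a * r k t) * \<bar>T k t\<bar>" by (rule mult_right_mono) simp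
        then show ?thesis by (simp add: a_def)
      qed
      then have sumT: "(\<Sum>k<N. \<bar>T k t\<bar>) \<le> wt ?x * B' t"
        unfolding B'_def sum_distrib_left by (intro sum_mono) auto
      have "sqrt (n2 t) \<le> (\<Sum>k<N. \<bar>T k t\<bar>)"
        using L2_set_le_sum_abs[of "\<lambda>k. T k t" "{..<N}"] by (simp add: L2_set_def n2_def)
      then have "n2 t \<le> (wt ?x * B' t)\<^sup>2" using sumT by (intro sqrt_le_D) simp
      moreover have "0 \<le> V t" by (simp add: V_def nsq_nonneg)
      ultimately have "2 * V t * n2 t \<le> 2 * V t * (wt ?x * B' t)\<^sup>2" by (intro mult_left_mono) auto
      moreover have "1 \<le> 2 * V t * n2 t" using d4(2)[of t] t \<delta> by simp
      moreover have "2 * V t * (wt ?x * B' t)\<^sup>2 = 2 * (Q (Z t) * (B' t)\<^sup>2)"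
        by (simp add: Q_def V_def power_mult_distrib)
      ultimately have "1 \<le> 2 * (Q (Z t) * (B' t)\<^sup>2)" by simp
      \<comment> \<open>From here 1 \<le> 2 * (4 * q * B'^2 + 1/4), and moving the 1/2 to the left
        gives the constant 16.\<close>
      also have "Q (Z t) * (B' t)\<^sup>2 \<le> (4 * q + t\<^sup>2) * (B' t)\<^sup>2"
        using KZt(3)[OF _ _ q] t \<delta> by (intro mult_right_mono) auto
      also have "\<dots> = 4 * q * (B' t)\<^sup>2 + (t * B' t)\<^sup>2" by (simp add: algebra_simps power_mult_distrib)
      also have "(t * B' t)\<^sup>2 \<le> (1/2)\<^sup>2"
        using d5(2)[of t] t \<delta> B'_nonneg by (intro power_mono) auto
      finally show ?thesis by (simp add: power2_eq_square)
    qed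

    have "mono_on {0<..<d1} B"
    proof (rule mono_onI)
      fix x y assume xy: "x \<in> {0<..<d1}" "y \<in> {0<..<d1}" "x \<le> y"
      show "B x \<le> B y"
      proof (rule DERIV_nonneg_imp_nondecreasing[OF xy(3)])
        fix u assume "x \<le> u" "u \<le> y"
        then show "\<exists>y. (B has_real_derivative y) (at u) \<and> 0 \<le> y"
          using xy by (intro exI[of _ "B' u"] conjI B_deriv B'_nonneg) auto
      qed
    qed
    moreover have "- real N \<le> B t" for t using B_bound[of t] by linarith
    ultimately obtain l where l: "\<forall>e>0. \<exists>\<eta>>0. \<forall>h. 0 < h \<and> h < \<eta> \<longrightarrow> \<bar>B h - l\<bar> < e"
      using mono_bounded_below_limit[OF d1(1)] by blast
    have "(B \<longlongrightarrow> l) (at_right 0)"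
      unfolding tendsto_iff eventually_at_right_field dist_real_def
    proof (intro allI impI)
      fix e :: real assume "e > 0"
      from l[rule_format, OF this]
      show "\<exists>b>0. \<forall>y>0. y < b \<longrightarrow> \<bar>B y - l\<bar> < e" by blast
    qed
    \<comment> \<open>Subtracting the limit \<open>l\<close> gives the limit 0 at 0. The factor 4 is
      the root of 16, and the summand \<open>t\<close> keeps the derivative positive even where
      \<open>B'\<close> vanishes.\<close>
    define \<phi> where "\<phi> t = (if t \<le> 0 then 0 else 4 * (B t - l) + t)" for t
    define R where "R t = 4 * B' t + 1" for t
    have "definable1 \<phi>"
      unfolding \<phi>_def by (intro deffun_if definability dB)
    moreover have "\<phi> 0 = 0" by (simp add: \<phi>_def)
    moreover have "(\<phi> \<longlongrightarrow> 0) (at_right 0)"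
    proof (rule Lim_transform_eventually)
      have "((\<lambda>t. 4 * (B t - l) + t) \<longlongrightarrow> 4 * (l - l) + 0) (at_right 0)"
        by (intro tendsto_intros \<open>(B \<longlongrightarrow> l) (at_right 0)\<close>)
      then show "((\<lambda>t. 4 * (B t - l) + t) \<longlongrightarrow> 0) (at_right 0)" by simp
      show "\<forall>\<^sub>F t in at_right 0. 4 * (B t - l) + t = \<phi> t"
        by (auto simp: \<phi>_def eventually_at_right_field intro!: exI[of _ 1])
    qed
    moreover have "(\<phi> has_real_derivative R t) (at t) \<and> isCont R t \<and> 0 < R t"
      if t: "0 < t" "t < \<delta>" for t
    proof (intro conjI)
      have "((\<lambda>t. 4 * (B t - l) + t) has_real_derivative R t) (at t)"
        unfolding R_def using B_deriv[of t] t \<delta> by (auto intro!: derivative_eq_intros)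
      then show "(\<phi> has_real_derivative R t) (at t)"
        by (rule has_field_derivative_transform_within_open[of _ _ _ "{0<..}"]) (use t in \<open>auto simp: \<phi>_def\<close>)
      show "isCont R t" unfolding R_def using t \<delta> by (intro continuous_intros B'_cont) auto
      show "0 < R t" using B'_nonneg[of t] by (simp add: R_def)
    qed
    moreover have "1 \<le> norm v * (1 + (norm x)\<^sup>2)\<^sup>2 * R \<bar>f x\<bar>"
      if v: "v \<in> D x" and fx: "0 < \<bar>f x\<bar>" "\<bar>f x\<bar> < \<delta>" for x v
    proof -
      let ?z = "vec_list x @ vec_list v" and ?t = "\<bar>f x\<bar>"
      have z: "take N ?z = vec_list x" "drop N ?z = vec_list v" by (simp_all add: length_vec_list N_def)
      have "?z \<in> rspace (N + N)" "Gr ?z" "\<bar>F (take N ?z)\<bar> = ?t"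
        unfolding Gr_def F_def z using v by (simp_all add: rspace_def length_vec_list list_vec_vec_list N_def)
      then have "W ?t (Q ?z)" unfolding W_def by blast
      from weighted[OF fx this] have "1 \<le> 16 * Q ?z * (B' ?t)\<^sup>2" .
      also have "\<dots> = (4 * (norm v * (1 + (norm x)\<^sup>2)\<^sup>2 * B' ?t))\<^sup>2"
        unfolding Q_def z wt_def nsq_norm list_vec_vec_list by (simp add: power_mult_distrib)
      finally have "1\<^sup>2 \<le> (4 * (norm v * (1 + (norm x)\<^sup>2)\<^sup>2 * B' ?t))\<^sup>2" by simp
      then have "1 \<le> 4 * (norm v * (1 + (norm x)\<^sup>2)\<^sup>2 * B' ?t)"
        by (rule power2_le_imp_le) (simp add: B'_nonneg)
      also have "\<dots> \<le> norm v * (1 + (norm x)\<^sup>2)\<^sup>2 * R ?t"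
        by (simp add: R_def algebra_simps)
      finally show ?thesis .
    qed
    ultimately show ?thesis using \<delta>(1) by blast
  qed
qed

lemma definable_real_fun_onI:
  assumes g: "definable1 g" and I: "defset (\<lambda>t. t \<in> I)"
  shows "definable_real_fun_on S I g"
proof -
  have "defpred (Suc (Suc 0)) (\<lambda>z. last (butlast z) \<in> I \<and> last z = g (last (butlast z)))"
    by (intro definability deffun_fun1[OF g] defpred_rel1[OF I] deffun_butlast)
  moreover have "{z \<in> rspace (Suc (Suc 0)). last (butlast z) \<in> I \<and> last z = g (last (butlast z))}
      = {[t, g t] |t. t \<in> I}"
    by (auto simp: rspace_2)
  ultimately show ?thesis
    by (simp add: defpred_def definable_real_fun_on_def numeral_2_eq_2)
qed

text \<open>The square root of \<open>\<psi>\<close> has derivative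
  \<open>R t / (2 * sqrt (\<psi> t))\<close>, and the factor gained,
  \<open>1 / (2 * sqrt (\<psi> t))\<close>, is at least the weight w as soon as
  \<open>\<psi> t\<close> is at most 1 / (2 w)^2. Pulling this threshold back by
  \<open>\<psi>\<close> gives \<open>\<kappa>\<close>.\<close>

lemma kurdyka_lojasiewicz:
  fixes D :: "real ^ 'p::enum \<Rightarrow> (real ^ 'p::enum) set" and f :: "real ^ 'p::enum \<Rightarrow> real"
  assumes cons: "conservative_field_for D f" and f: "definable_fun S f" and D: "definable_setmap S D"
  shows "\<exists>\<rho>>0. \<exists>\<phi> \<kappa>.
           definable_real_fun_on S {0..<\<rho>} \<phi>
         \<and> strict_mono_on {0..<\<rho>} \<phi>
         \<and> \<phi> ` {0..<\<rho>} \<subseteq> {0..}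
         \<and> (\<forall>t\<in>{0<..<\<rho>}. \<phi> differentiable (at t))
         \<and> continuous_on {0<..<\<rho>} (deriv \<phi>)
         \<and> \<phi> 0 = 0
         \<and> definable_real_fun_on S {0..} \<kappa>
         \<and> continuous_on {0..} \<kappa>
         \<and> (\<forall>t\<ge>0. 0 < \<kappa> t \<and> \<kappa> t < \<rho>)
         \<and> (\<forall>x. \<forall>v\<in>D x. 0 < \<bar>f x\<bar> \<and> \<bar>f x\<bar> \<le> \<kappa> (norm x) \<longrightarrow>
                 norm v * deriv \<phi> \<bar>f x\<bar> \<ge> 1)"
proof -
  obtain \<rho> \<psi> R where \<rho>: "\<rho> > 0" and d\<psi>: "definable1 \<psi>" and \<psi>0: "\<psi> 0 = 0"
    and lim: "(\<psi> \<longlongrightarrow> 0) (at_right 0)"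
    and \<psi>': "\<And>t. 0 < t \<Longrightarrow> t < \<rho> \<Longrightarrow> (\<psi> has_real_derivative R t) (at t)"
    and R: "\<And>t. 0 < t \<Longrightarrow> t < \<rho> \<Longrightarrow> isCont R t" "\<And>t. 0 < t \<Longrightarrow> t < \<rho> \<Longrightarrow> 0 < R t"
    and KL: "\<And>x v. v \<in> D x \<Longrightarrow> 0 < \<bar>f x\<bar> \<Longrightarrow> \<bar>f x\<bar> < \<rho> \<Longrightarrow>
      1 \<le> norm v * (1 + (norm x)\<^sup>2)\<^sup>2 * R \<bar>f x\<bar>"
    using global_desingularization[OF cons f D] by blast
  have cont0: "continuous_on {0..<\<rho>} \<psi>"
    unfolding continuous_on_eq_continuous_within
  proof
    fix t assume t: "t \<in> {0..<\<rho>}"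
    show "continuous (at t within {0..<\<rho>}) \<psi>"
    proof (cases "t = 0")
      case True
      have "at 0 within {0..<\<rho>} = at_right 0"
        using \<rho> by (intro at_within_nhd[of _ "{-1<..<\<rho>}"]) auto
      then show ?thesis using True lim \<psi>0 by (simp add: continuous_within)
    next
      case False
      then have "isCont \<psi> t" using t by (intro DERIV_isCont[OF \<psi>']) auto
      then show ?thesis by (rule continuous_at_imp_continuous_at_within)
    qed
  qed
  have mono: "\<psi> s < \<psi> t" if "0 \<le> s" "s < t" "t < \<rho>" for s t
  proof (rule DERIV_pos_imp_increasing_open[OF that(2)])
    show "\<exists>y. (\<psi> has_real_derivative y) (at x) \<and> 0 < y" if "s < x" "x < t" for x
      using \<psi>'[of x] R(2)[of x] that \<open>0 \<le> s\<close> \<open>t < \<rho>\<close> by auto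
    show "continuous_on {s..t} \<psi>" by (rule continuous_on_subset[OF cont0]) (use that in auto)
  qed
  have \<psi>_pos: "0 < \<psi> t" if "0 < t" "t < \<rho>" for t using mono[of 0 t] that \<psi>0 by simp
  \<comment> \<open>The sign of \<open>\<psi>\<close> is known only on \<open>[0, \<rho>)\<close>;
    the absolute value keeps \<open>\<phi>\<close> nonnegative and definable on the whole
    line.\<close>
  define \<phi> where "\<phi> t = sqrt \<bar>\<psi> t\<bar>" for t
  have \<phi>_eq: "\<phi> t = sqrt (\<psi> t)" if "0 \<le> t" "t < \<rho>" for t
    using \<psi>_pos[of t] that \<psi>0 by (cases "t = 0") (auto simp: \<phi>_def)
  have \<phi>': "(\<phi> has_real_derivative R t / (2 * sqrt (\<psi> t))) (at t)" if t: "0 < t" "t < \<rho>" for t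
  proof (rule has_field_derivative_transform_within_open[of _ _ _ "{0<..<\<rho>}"])
    show "((\<lambda>t. sqrt (\<psi> t)) has_real_derivative R t / (2 * sqrt (\<psi> t))) (at t)"
      using \<psi>_pos[OF t] by (auto intro!: derivative_eq_intros \<psi>' t simp: field_simps)
  qed (use t \<phi>_eq in auto)
  then have deriv: "deriv \<phi> t = R t / (2 * sqrt (\<psi> t))" if "0 < t" "t < \<rho>" for t
    using that by (intro DERIV_imp_deriv)
  \<comment> \<open>An interior point, so that \<open>\<kappa>\<close> takes its values in the
    compact interval \<open>[0, c]\<close> and stays below \<open>\<rho>\<close>.\<close>
  define c where "c = \<rho> / 2"
  have c: "0 < c" "c < \<rho>" using \<rho> by (auto simp: c_def)
  \<comment> \<open>The second term is 1 / (2 w)^2 for w = (1 + r^2)^2. The cap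
    \<open>\<psi> c\<close> keeps \<open>h\<close> in the range of \<open>\<psi>\<close> on
    \<open>[0, c]\<close>, where the inverse exists and is continuous by compactness.\<close>
  define h where "h r = min (\<psi> c) (1 / (4 * (1 + r\<^sup>2) ^ 4))" for r :: real
  have den: "0 < 4 * (1 + r\<^sup>2) ^ 4" for r :: real by (intro mult_pos_pos zero_less_power add_pos_nonneg) auto
  have h_pos: "0 < h r" for r
    unfolding h_def min_less_iff_conj using \<psi>_pos[OF c] den[of r] by (intro conjI divide_pos_pos) auto
  define G where "G = inv_into {0..c} \<psi>"
  define \<kappa> where "\<kappa> r = G (h r)" for r
  have inj: "inj_on \<psi> {0..c}"
    by (rule linorder_inj_onI) (use mono c in force)+
  have cont_c: "continuous_on {0..c} \<psi>" by (rule continuous_on_subset[OF cont0]) (use c in auto)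
  have image: "\<psi> ` {0..c} = {0..\<psi> c}"
  proof (intro subset_antisym subsetI)
    fix y assume "y \<in> \<psi> ` {0..c}"
    then obtain t where t: "0 \<le> t" "t \<le> c" "y = \<psi> t" by auto
    then show "y \<in> {0..\<psi> c}"
      using mono[of 0 t] mono[of t c] c \<psi>0 by (cases "t = 0"; cases "t = c") auto
  next
    fix y assume "y \<in> {0..\<psi> c}"
    then have "\<exists>x\<ge>0. x \<le> c \<and> \<psi> x = y"
      using \<psi>0 c cont_c by (intro IVT') auto
    then show "y \<in> \<psi> ` {0..c}" by auto
  qed
  have h_image: "h r \<in> \<psi> ` {0..c}" for r
    unfolding image using h_pos[of r] by (simp add: h_def)
  have \<kappa>: "\<kappa> r \<in> {0..c}" "\<psi> (\<kappa> r) = h r" for r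
    unfolding \<kappa>_def G_def by (rule inv_into_into[OF h_image], rule f_inv_into_f[OF h_image])
  have \<kappa>_pos: "0 < \<kappa> r" for r
    using \<kappa>[of r] h_pos[of r] \<psi>0 by (cases "\<kappa> r = 0") auto
  have contG: "continuous_on (\<psi> ` {0..c}) G"
    unfolding G_def by (rule continuous_on_inv[OF cont_c compact_Icc]) (simp add: inv_into_f_f inj)
  have cont_h: "continuous_on UNIV h"
    unfolding h_def by (intro continuous_intros ballI less_imp_neq[symmetric] den)
  have "continuous_on UNIV \<kappa>"
    unfolding \<kappa>_def
    by (rule continuous_on_compose2[OF contG cont_h]) (use h_image in blast)
  have dh: "definable1 h"
    unfolding h_def min_def by (intro deffun_if definability)
  have d\<kappa>: "definable1 \<kappa>"
  proof (rule deffun_description[where P = "\<lambda>z s. 0 \<le> s \<and> s \<le> c \<and> \<psi> s = h (last z)"])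
    show "defpred (Suc (Suc 0)) (\<lambda>z. 0 \<le> last z \<and> last z \<le> c \<and> \<psi> (last z) = h (last (butlast z)))"
      by (intro definability deffun_fun1[OF d\<psi>] deffun_fun1[OF dh] deffun_butlast)
    show "s = \<kappa> (last x) \<longleftrightarrow> 0 \<le> s \<and> s \<le> c \<and> \<psi> s = h (last x)" for x s
      using \<kappa>[of "last x"] inj_onD[OF inj, of s "\<kappa> (last x)"] by auto
  qed
  have ineq: "1 \<le> norm v * deriv \<phi> \<bar>f x\<bar>"
    if v: "v \<in> D x" and fx: "0 < \<bar>f x\<bar>" "\<bar>f x\<bar> \<le> \<kappa> (norm x)" for x v
  proof -
    let ?t = "\<bar>f x\<bar>" and ?w = "(1 + (norm x)\<^sup>2)\<^sup>2"
    have t: "?t < \<rho>" using fx(2) \<kappa>(1)[of "norm x"] c by auto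
    have w: "0 < ?w" by (intro zero_less_power add_pos_nonneg) auto
    have "\<psi> ?t \<le> \<psi> (\<kappa> (norm x))"
      using mono[of ?t "\<kappa> (norm x)"] fx \<kappa>(1)[of "norm x"] c by (cases "?t = \<kappa> (norm x)") auto
    also have "\<dots> \<le> 1 / (4 * (1 + (norm x)\<^sup>2) ^ 4)" unfolding \<kappa>(2) h_def by simp
    also have "\<dots> = (1 / (2 * ?w))\<^sup>2" by (simp add: power_divide power_mult_distrib)
    finally have "sqrt (\<psi> ?t) \<le> 1 / (2 * ?w)" using w by (intro real_le_lsqrt) (auto simp: less_imp_le \<psi>_pos fx t)
    then have "2 * ?w * sqrt (\<psi> ?t) \<le> 1" using w by (simp add: pos_le_divide_eq mult.commute)
    moreover have "0 < sqrt (\<psi> ?t)" using \<psi>_pos fx t by simp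
    ultimately have "?w \<le> 1 / (2 * sqrt (\<psi> ?t))" by (simp add: pos_le_divide_eq mult_ac)
    then have "norm v * R ?t * ?w \<le> norm v * R ?t * (1 / (2 * sqrt (\<psi> ?t)))"
      using R(2)[OF fx(1) t] by (intro mult_left_mono) auto
    then show ?thesis using KL[OF v fx(1) t] deriv[OF fx(1) t] by (simp add: mult_ac)
  qed
  have "continuous_on {0<..<\<rho>} (deriv \<phi>)"
  proof -
    have "continuous_on {0<..<\<rho>} (\<lambda>t. R t / (2 * sqrt (\<psi> t)))"
      using R(1) \<psi>_pos
      by (intro continuous_intros continuous_at_imp_continuous_on continuous_on_subset[OF cont0]) force+
    then show ?thesis using deriv by (subst continuous_on_cong[OF refl]) auto
  qed
  moreover have "definable1 \<phi>" unfolding \<phi>_def by (intro deffun_sqrt_abs d\<psi>)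
  then have "definable_real_fun_on S {0..<\<rho>} \<phi>"
    by (rule definable_real_fun_onI) (simp, intro definability)
  moreover have "definable_real_fun_on S {0..} \<kappa>"
    by (rule definable_real_fun_onI[OF d\<kappa>]) (simp, intro definability)
  moreover have "strict_mono_on {0..<\<rho>} \<phi>"
    using mono \<phi>_eq by (auto intro!: strict_mono_onI)
  moreover have "\<phi> ` {0..<\<rho>} \<subseteq> {0..}" by (auto simp: \<phi>_def)
  moreover have "\<phi> differentiable (at t)" if "t \<in> {0<..<\<rho>}" for t
    using \<phi>'[of t] that unfolding real_differentiable_def by auto
  moreover have "continuous_on {0..} \<kappa>"
    using \<open>continuous_on UNIV \<kappa>\<close> by (rule continuous_on_subset) simp
  moreover have "0 < \<kappa> t \<and> \<kappa> t < \<rho>" for t using \<kappa>_pos[of t] \<kappa>(1)[of t] c by auto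
  moreover have "\<phi> 0 = 0" by (simp add: \<phi>_def \<psi>0)
  ultimately show ?thesis using \<rho> ineq by (intro exI[of _ \<rho>] conjI exI[of _ \<phi>] exI[of _ \<kappa>]) auto
qed

end

theorem theorem6:
  fixes S :: "nat \<Rightarrow> real list set set"
    and D :: "real ^ 'p::enum \<Rightarrow> (real ^ 'p::enum) set"
    and f :: "real ^ 'p::enum \<Rightarrow> real"
  assumes "o_minimal S"
    and "conservative_field_for D f"
    and "definable_fun S f"
    and "definable_setmap S D"
  shows "\<exists>\<rho>>0. \<exists>\<phi> \<kappa>.
           definable_real_fun_on S {0..<\<rho>} \<phi>
         \<and> strict_mono_on {0..<\<rho>} \<phi>
         \<and> \<phi> ` {0..<\<rho>} \<subseteq> {0..}
         \<and> (\<forall>t\<in>{0<..<\<rho>}. \<phi> differentiable (at t))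
         \<and> continuous_on {0<..<\<rho>} (deriv \<phi>)
         \<and> \<phi> 0 = 0
         \<and> definable_real_fun_on S {0..} \<kappa>
         \<and> continuous_on {0..} \<kappa>
         \<and> (\<forall>t\<ge>0. 0 < \<kappa> t \<and> \<kappa> t < \<rho>)
         \<and> (\<forall>x. \<forall>v\<in>D x. 0 < \<bar>f x\<bar> \<and> \<bar>f x\<bar> \<le> \<kappa> (norm x) \<longrightarrow>
                 norm v * deriv \<phi> \<bar>f x\<bar> \<ge> 1)"
proof -
  interpret o_minimal_structure S by standard (rule assms(1))
  show ?thesis by (rule kurdyka_lojasiewicz[OF assms(2-4)])
qed

end
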